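(* Let $G$ be an $n$-vertex graph that is not a tree. Then $g_{ce}(G)\leq n-2$; that is, there are at most $n-2$ subgraphs of $G$, each of which is a cycle or a single edge, such that every edge of $G$ belongs to at least one of them.
   Context: Graphs are finite and simple, with at least one vertex. A tree is a connected acyclic graph (a single vertex is a tree). A cover of $G=(V,E)$ by cycles and edges is a collection of subsets $E_1,\dots,E_k\subseteq E$ whose union is $E$ such that each subgraph $H_i=(V(E_i),E_i)$ is a cycle or a single edge, where $V(E_i)$ is the set of vertices incident to edges in $E_i$; the sets $E_i$ need not be disjoint, and $k=0$ is used if $E=\emptyset$. $g_{ce}(G)$ denotes the minimum number $k$ of subgraphs in a cover of $G$ by cycles and edges. *)

theory Defs
  imports Main
begin

definition simple_graph :: "'a set \<Rightarrow> 'a set set \<Rightarrow> bool" where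
  "simple_graph V E \<longleftrightarrow> finite V \<and> V \<noteq> {} \<and> E \<subseteq> {e. e \<subseteq> V \<and> card e = 2}"

definition connected_graph :: "'a set \<Rightarrow> 'a set set \<Rightarrow> bool" where
  "connected_graph V E \<longleftrightarrow> (\<forall>u\<in>V. \<forall>v\<in>V. (u, v) \<in> {(x, y). {x, y} \<in> E}\<^sup>*)"

text \<open>The graph with vertex set \<open>V\<close> and edge set \<open>E\<close> is itself a cycle, of length at least 3;
  the index \<open>Suc i mod length vs\<close> supplies the closing edge from the last vertex to the first.\<close>

definition is_cycle :: "'a set \<Rightarrow> 'a set set \<Rightarrow> bool" where
  "is_cycle V E \<longleftrightarrow> (\<exists>vs. distinct vs \<and> 3 \<le> length vs \<and> V = set vs \<and>
     E = {{vs ! i, vs ! (Suc i mod length vs)} | i. i < length vs})"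

definition is_single_edge :: "'a set \<Rightarrow> 'a set set \<Rightarrow> bool" where
  "is_single_edge V E \<longleftrightarrow> (\<exists>u v. u \<noteq> v \<and> V = {u, v} \<and> E = {{u, v}})"

definition acyclic_graph :: "'a set \<Rightarrow> 'a set set \<Rightarrow> bool" where
  "acyclic_graph V E \<longleftrightarrow> \<not> (\<exists>W F. W \<subseteq> V \<and> F \<subseteq> E \<and> is_cycle W F)"

definition is_tree :: "'a set \<Rightarrow> 'a set set \<Rightarrow> bool" where
  "is_tree V E \<longleftrightarrow> simple_graph V E \<and> connected_graph V E \<and> acyclic_graph V E"

text \<open>A cover is a list \<open>[E\<^sub>1, \<dots>, E\<^sub>k]\<close> of edge sets; since edges are sets of
  vertices, \<open>\<Union>F\<close> is the set of vertices incident to edges in \<open>F\<close>.\<close>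

definition ce_cover :: "'a set set \<Rightarrow> 'a set set list \<Rightarrow> bool" where
  "ce_cover E Es \<longleftrightarrow> (\<forall>F\<in>set Es. F \<subseteq> E \<and> (is_cycle (\<Union>F) F \<or> is_single_edge (\<Union>F) F)) \<and>
     \<Union>(set Es) = E"

definition g_ce :: "'a set set \<Rightarrow> nat" where
  "g_ce E = (LEAST k. \<exists>Es. ce_cover E Es \<and> length Es = k)"

text \<open>Covers exist, so the minimum in \<open>g_ce\<close> is attained.\<close>

lemma ce_cover_exists:
  assumes "simple_graph V E"
  shows "\<exists>Es. ce_cover E Es"
proof -
  have "E \<subseteq> Pow V" "finite (Pow V)"
    using assms unfolding simple_graph_def by auto
  then have "finite E"
    by (rule finite_subset)
  then obtain es where es: "set es = E"
    using finite_list by blast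
  have edge: "is_single_edge (\<Union>{e}) {e}" if "e \<in> E" for e
  proof -
    have "card e = 2"
      using assms that unfolding simple_graph_def by blast
    then show ?thesis
      unfolding is_single_edge_def by (auto simp: card_2_iff)
  qed
  have "ce_cover E (map (\<lambda>e. {e}) es)"
    unfolding ce_cover_def using es edge by auto
  then show ?thesis ..
qed

lemma g_ce_attained:
  assumes "simple_graph V E"
  shows "\<exists>Es. ce_cover E Es \<and> length Es = g_ce E"
proof -
  have "\<exists>k Es. ce_cover E Es \<and> length Es = k"
    using ce_cover_exists[OF assms] by blast
  then show ?thesis
    unfolding g_ce_def by (rule LeastI_ex)
qed

end

theory Submission
  imports Defs
begin

text \<open>
  It suffices to treat connected graphs, as the bounds \<open>n\<^sub>i - 1\<close> for two parts without edges between
  them add up to \<open>n - 2\<close>. Let \<open>xy\<close> be an edge and let \<open>B\<close> be the set of neighbours of \<open>x\<close> that are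
  neither \<open>y\<close> nor neighbours of \<open>y\<close>. The Kelmans shift replaces the edges \<open>xb\<close>, \<open>b \<in> B\<close>, by \<open>yb\<close>. A cover
  of the shifted graph can be turned into a cover of the original one with equally many members: a
  cycle through \<open>x\<close> and \<open>y\<close> consists of two segments between \<open>x\<close> and \<open>y\<close>, and reversing any of
  them gives again a cycle. Segments that end at \<open>B\<close> have to be reversed; this exchanges \<open>x\<close> and \<open>y\<close> at
  certain common neighbours, which forces reversals in other cycles, but never contradictory ones.
  Repeated shifts towards \<open>y\<close> make \<open>y\<close> adjacent to all other vertices and keep the number of edges.

  If \<open>y\<close> is adjacent to all vertices of the rest \<open>H\<close>, then a path in \<open>H\<close> is closed by \<open>y\<close> to a cycle (or
  to a single edge, if it is a vertex), so one needs at most \<open>n - 2\<close> paths that cover the edges of \<open>H\<close>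
  and have every vertex of \<open>H\<close> as an end. A rotation argument in the style of Lovasz decomposes
  \<open>H\<close> into paths such that each vertex \<open>v\<close> is an end \<open>\<nu> v\<close> times, whenever \<open>\<nu> v\<close> has the parity of the
  degree of \<open>v\<close> and \<open>\<nu>\<close> vanishes on at most one vertex that is not isolated. If \<open>H\<close> has a vertex of
  odd degree, use \<open>\<nu> v \<in> {1, 2}\<close>; if all degrees are even and \<open>H\<close> has an edge at \<open>v\<^sub>0\<close>, use \<open>\<nu> v\<^sub>0 = 0\<close> and
  \<open>\<nu> v = 2\<close> otherwise, and prolong one path to \<open>v\<^sub>0\<close>. If \<open>H\<close> has no edges, the graph has \<open>n - 1\<close> edges,
  and a cycle together with the remaining edges suffices.
\<close>

section \<open>Paths and cycles as vertex lists\<close>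

fun path_edges :: "'a list \<Rightarrow> 'a set set" where
  "path_edges (u # v # vs) = insert {u, v} (path_edges (v # vs))"
| "path_edges _ = {}"

definition cycle_edges :: "'a list \<Rightarrow> 'a set set" where
  "cycle_edges vs = path_edges (vs @ [hd vs])"

definition cycle_or_edge :: "'a set set \<Rightarrow> bool" where
  "cycle_or_edge F \<longleftrightarrow> is_cycle (\<Union>F) F \<or> is_single_edge (\<Union>F) F"

lemma path_edges_Cons: "ws \<noteq> [] \<Longrightarrow> path_edges (v # ws) = insert {v, hd ws} (path_edges ws)"
  by (cases ws) auto

lemma path_edges_append:
  "path_edges (xs @ v # ys) = path_edges (xs @ [v]) \<union> path_edges (v # ys)"
proof (induction xs)
  case (Cons a xs)
  then show ?case by (cases xs) auto
qed simp

lemma path_edges_snoc: "ws \<noteq> [] \<Longrightarrow> path_edges (ws @ [v]) = insert {last ws, v} (path_edges ws)"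
  by (induction ws) (auto simp: path_edges_Cons)

lemma path_edges_rev [simp]: "path_edges (rev xs) = path_edges xs"
proof (induction xs)
  case (Cons a xs)
  then show ?case
    by (cases "xs = []") (auto simp: path_edges_Cons path_edges_snoc last_rev insert_commute)
qed simp

lemma path_edges_subset: "e \<in> path_edges vs \<Longrightarrow> e \<subseteq> set vs"
  by (induction vs rule: path_edges.induct) auto

lemma Union_path_edges: "2 \<le> length vs \<Longrightarrow> \<Union>(path_edges vs) = set vs"
proof (induction vs rule: path_edges.induct)
  case (1 u v vs)
  then show ?case by (cases vs) auto
qed auto

lemma path_edges_nth: "path_edges vs = {{vs ! i, vs ! Suc i} | i. Suc i < length vs}"
proof (induction vs rule: path_edges.induct)
  case (1 u v vs)
  have "{{(u # v # vs) ! i, (u # v # vs) ! Suc i} | i. Suc i < length (u # v # vs)} =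
    insert {u, v} {{(v # vs) ! i, (v # vs) ! Suc i} | i. Suc i < length (v # vs)}" (is "?L = ?R")
  proof
    show "?L \<subseteq> ?R"
    proof
      fix e assume "e \<in> ?L"
      then obtain i where i: "e = {(u # v # vs) ! i, (u # v # vs) ! Suc i}"
        "Suc i < length (u # v # vs)" by blast
      then show "e \<in> ?R" by (cases i) auto
    qed
    have "{(v # vs) ! i, (v # vs) ! Suc i} \<in> ?L" if "Suc i < length (v # vs)" for i
      using that by (intro CollectI exI[of _ "Suc i"]) auto
    moreover have "{u, v} \<in> ?L" by (intro CollectI exI[of _ 0]) auto
    ultimately show "?R \<subseteq> ?L" by auto
  qed
  with 1 show ?case by simp
qed auto

lemma cycle_edges_nth:
  assumes "vs \<noteq> []"
  shows "cycle_edges vs = {{vs ! i, vs ! (Suc i mod length vs)} | i. i < length vs}"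
proof -
  have "(vs @ [hd vs]) ! Suc i = vs ! (Suc i mod length vs)" if "i < length vs" for i
  proof (cases "Suc i = length vs")
    case True
    then show ?thesis using assms by (simp add: nth_append hd_conv_nth)
  next
    case False
    then show ?thesis using that by (simp add: nth_append)
  qed
  then have "{(vs @ [hd vs]) ! i, (vs @ [hd vs]) ! Suc i} = {vs ! i, vs ! (Suc i mod length vs)}"
    if "i < length vs" for i
    using that by (simp add: nth_append)
  then show ?thesis
    unfolding cycle_edges_def path_edges_nth by (intro Collect_cong ex_cong1) auto
qed

lemma Union_cycle_edges: "2 \<le> length vs \<Longrightarrow> \<Union>(cycle_edges vs) = set vs"
  unfolding cycle_edges_def by (subst Union_path_edges) (cases vs; auto)+

text \<open>Trades modular indexing for closed vertex lists, so that rotating and reversing cycles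
  become list operations.\<close>

lemma is_cycle_iff:
  "is_cycle (\<Union>F) F \<longleftrightarrow> (\<exists>vs. distinct vs \<and> 3 \<le> length vs \<and> F = cycle_edges vs)"
proof
  assume "is_cycle (\<Union>F) F"
  then obtain vs where vs: "distinct vs" "3 \<le> length vs"
    "F = {{vs ! i, vs ! (Suc i mod length vs)} | i. i < length vs}"
    unfolding is_cycle_def by blast
  then have "vs \<noteq> []" by auto
  then have "F = cycle_edges vs" by (rule trans[OF vs(3) cycle_edges_nth[symmetric]])
  with vs show "\<exists>vs. distinct vs \<and> 3 \<le> length vs \<and> F = cycle_edges vs" by blast
next
  assume "\<exists>vs. distinct vs \<and> 3 \<le> length vs \<and> F = cycle_edges vs"
  then obtain vs where vs: "distinct vs" "3 \<le> length vs" "F = cycle_edges vs" by blast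
  then have ne: "vs \<noteq> []" and U: "\<Union>F = set vs" using Union_cycle_edges[of vs] by auto
  have "F = {{vs ! i, vs ! (Suc i mod length vs)} | i. i < length vs}"
    by (rule trans[OF vs(3) cycle_edges_nth[OF ne]])
  with vs(1,2) U show "is_cycle (\<Union>F) F"
    unfolding is_cycle_def by blast
qed

lemma cycle_edges_Cons: "cycle_edges (v # ws) = path_edges (v # ws @ [v])"
  by (simp add: cycle_edges_def)

lemma cycle_edges_closed:
  "ws \<noteq> [] \<Longrightarrow> cycle_edges (v # ws) = {{v, hd ws}, {v, last ws}} \<union> path_edges ws"
  unfolding cycle_edges_Cons by (auto simp: path_edges_Cons path_edges_snoc insert_commute)

lemma cycle_edges_rotate: "cycle_edges (xs @ ys) = cycle_edges (ys @ xs)"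
proof (cases "xs = [] \<or> ys = []")
  case False
  then obtain x xs' y ys' where "xs = x # xs'" "ys = y # ys'" by (meson neq_Nil_conv)
  then show ?thesis
    using path_edges_append[of "x # xs'" y "ys' @ [x]"] path_edges_append[of "y # ys'" x "xs' @ [y]"]
    by (auto simp: cycle_edges_def)
qed auto

lemma cycle_or_edge_cycle:
  "distinct vs \<Longrightarrow> 3 \<le> length vs \<Longrightarrow> cycle_or_edge (cycle_edges vs)"
  unfolding cycle_or_edge_def is_cycle_iff by blast

lemma cycle_or_edge_single: "u \<noteq> v \<Longrightarrow> cycle_or_edge {{u, v}}"
  unfolding cycle_or_edge_def is_single_edge_def by auto

lemma cycle_or_edge_cases:
  assumes "cycle_or_edge F"
  obtains (edge) u v where "u \<noteq> v" "F = {{u, v}}"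
  | (cycle) vs where "distinct vs" "3 \<le> length vs" "F = cycle_edges vs"
  using assms unfolding cycle_or_edge_def is_cycle_iff is_single_edge_def by blast

lemma ce_cover_iff:
  "ce_cover E Es \<longleftrightarrow> (\<forall>F\<in>set Es. F \<subseteq> E \<and> cycle_or_edge F) \<and> \<Union>(set Es) = E"
  unfolding ce_cover_def cycle_or_edge_def ..

definition coverable :: "'a set set \<Rightarrow> nat \<Rightarrow> bool" where
  "coverable E k \<longleftrightarrow> (\<exists>Es. ce_cover E Es \<and> length Es \<le> k)"

section \<open>Kelmans shifts\<close>

text \<open>Colours \<open>\<eta>\<close> that are constant along the functional graph \<open>a \<mapsto> f a\<close> on \<open>D\<close> and prescribed
  off \<open>D\<close>: no conflict arises because every orbit leaves \<open>D\<close> at most once.\<close>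

lemma colouring_along_function:
  assumes "D \<inter> B = {}"
  obtains \<eta> :: "'a \<Rightarrow> bool" where "\<And>b. b \<in> B \<Longrightarrow> \<eta> b" "\<And>c. c \<notin> D \<Longrightarrow> c \<notin> B \<Longrightarrow> \<not> \<eta> c"
    "\<And>a. a \<in> D \<Longrightarrow> \<eta> a = \<eta> (f a)"
proof
  define R where "R = {(a, f a) | a. a \<in> D}"
  define \<eta> where "\<eta> s \<longleftrightarrow> (\<exists>b\<in>B. (s, b) \<in> R\<^sup>*)" for s
  show "\<eta> b" if "b \<in> B" for b using that by (auto simp: \<eta>_def)
  show "\<not> \<eta> c" if "c \<notin> D" "c \<notin> B" for c
    using that by (auto simp: \<eta>_def R_def elim: converse_rtranclE)
  show "\<eta> a = \<eta> (f a)" if "a \<in> D" for a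
  proof
    assume "\<eta> a"
    then obtain b where "b \<in> B" "(a, b) \<in> R\<^sup>*" by (auto simp: \<eta>_def)
    \<comment> \<open>Elements of \<open>D\<close> are not in \<open>B\<close>, so the walk from
      \<open>a\<close> to \<open>b\<close> has a first step, and the only step out of
      \<open>a\<close> leads to \<open>f a\<close>.\<close>
    moreover from this have "a \<noteq> b" using assms that by blast
    ultimately show "\<eta> (f a)"
      by (auto simp: \<eta>_def R_def elim: converse_rtranclE)
  next
    assume "\<eta> (f a)"
    moreover have "(a, f a) \<in> R" using that by (auto simp: R_def)
    ultimately show "\<eta> a" by (auto simp: \<eta>_def intro: converse_rtrancl_into_rtrancl)
  qed
qed

text \<open>\<open>E'\<close> is the shifted graph, and \<open>\<eta> s\<close> tells whether the edge \<open>ys\<close> of \<open>E'\<close> becomes \<open>xs\<close> in the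
  lifted cover; for a common neighbour \<open>s\<close> the edge \<open>xs\<close> then becomes \<open>ys\<close>.\<close>

locale lifting =
  fixes x y :: 'a and E E' :: "'a set set" and \<eta> :: "'a \<Rightarrow> bool"
  assumes xy: "{x, y} \<in> E" "x \<noteq> y"
    and at_y: "\<And>s. s \<noteq> x \<Longrightarrow> {y, s} \<in> E' \<Longrightarrow> {if \<eta> s then x else y, s} \<in> E"
    and at_x: "\<And>a. a \<noteq> y \<Longrightarrow> {x, a} \<in> E' \<Longrightarrow> {x, a} \<in> E \<and> {y, a} \<in> E"
    and off: "\<And>e. e \<in> E' \<Longrightarrow> x \<notin> e \<Longrightarrow> y \<notin> e \<Longrightarrow> e \<in> E"
begin

definition seg :: "'a list \<Rightarrow> 'a set set" where
  "seg u = path_edges (x # u @ [y])"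

text \<open>In \<open>E'\<close> the last vertex of a segment is the one attached to
  \<open>y\<close>. If its colour demands \<open>x\<close> instead, reversing the segment achieves
  this without touching the inner edges.\<close>

definition flip :: "'a list \<Rightarrow> 'a list" where
  "flip u = (if u \<noteq> [] \<and> \<eta> (last u) then rev u else u)"

lemma seg_Nil [simp]: "seg [] = {{x, y}}"
  by (simp add: seg_def)

lemma seg_eq: "u \<noteq> [] \<Longrightarrow> seg u = {{x, hd u}, {y, last u}} \<union> path_edges u"
  by (auto simp: seg_def path_edges_Cons path_edges_snoc insert_commute)

lemma set_flip [simp]: "set (flip u) = set u" "distinct (flip u) = distinct u" "length (flip u) = length u"
  by (auto simp: flip_def)

lemma path_edges_flip [simp]: "path_edges (flip u) = path_edges u"
  by (simp add: flip_def)

lemma path_edges_off: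
  assumes "x \<notin> set u" "y \<notin> set u"
  shows "{x, a} \<notin> path_edges u" "{y, a} \<notin> path_edges u" "{a, x} \<notin> path_edges u" "{a, y} \<notin> path_edges u"
  using assms path_edges_subset by fastforce+

lemma path_edges_lift:
  assumes "x \<notin> set u" "y \<notin> set u" "path_edges u \<subseteq> E'"
  shows "path_edges u \<subseteq> E"
proof
  fix e assume "e \<in> path_edges u"
  moreover from this have "x \<notin> e" "y \<notin> e" using assms path_edges_subset by blast+
  ultimately show "e \<in> E" using assms off by blast
qed

text \<open>Reversal may attach the old first vertex to \<open>y\<close>: it is a neighbour of
  \<open>x\<close> in \<open>E'\<close>, so by \<open>at_x\<close> both edges are in
  \<open>E\<close>. For the old last vertex, \<open>at_y\<close> provides exactly the edge that its
  colour asks for.\<close>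

lemma seg_flip_subset:
  assumes "x \<notin> set u" "y \<notin> set u" "seg u \<subseteq> E'"
  shows "seg (flip u) \<subseteq> E"
proof (cases "u = []")
  case True
  then show ?thesis using xy by (simp add: flip_def)
next
  case False
  note u = seg_eq[OF this]
  have "hd u \<noteq> y" "last u \<noteq> x" using assms False by auto
  then have "{x, hd u} \<in> E" "{y, hd u} \<in> E" "{if \<eta> (last u) then x else y, last u} \<in> E"
    using at_x[of "hd u"] at_y[of "last u"] assms(3) u by auto
  moreover have "path_edges u \<subseteq> E" using path_edges_lift assms u by blast
  moreover have "flip u \<noteq> []" using False by (simp add: flip_def)
  moreover have "hd (flip u) = (if \<eta> (last u) then last u else hd u)"
    "last (flip u) = (if \<eta> (last u) then hd u else last u)"
    using False by (auto simp: flip_def hd_rev last_rev)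
  ultimately show ?thesis
    by (auto simp: seg_eq split: if_splits)
qed

lemma seg_flip_y:
  assumes "x \<notin> set u" "y \<notin> set u" "{y, s} \<in> seg u" "s \<noteq> x"
  shows "{if \<eta> s then x else y, s} \<in> seg (flip u)"
proof -
  have ne: "u \<noteq> []" using assms xy by (auto simp: doubleton_eq_iff)
  then have "y \<noteq> hd u" using assms by auto
  then have "s = last u" using assms ne xy path_edges_off[of u s]
    by (auto simp: seg_eq doubleton_eq_iff)
  moreover have "flip u \<noteq> []" using ne by (simp add: flip_def)
  ultimately show ?thesis using ne by (auto simp: seg_eq) (auto simp: flip_def hd_rev)
qed

lemma seg_x:
  assumes "x \<notin> set u" "y \<notin> set u" "{x, a} \<in> seg u" "a \<noteq> y"
  shows "u \<noteq> []" "a = hd u"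
proof -
  show ne: "u \<noteq> []" using assms xy by (auto simp: doubleton_eq_iff)
  then have "x \<noteq> last u" using assms by auto
  then show "a = hd u" using assms ne xy path_edges_off[of u a]
    by (auto simp: seg_eq doubleton_eq_iff)
qed

text \<open>The neighbour of \<open>x\<close> is the first vertex of the segment, but
  \<open>flip\<close> consults the last one; hence the premise that both have the same
  colour.\<close>

lemma seg_flip_x:
  assumes "x \<notin> set u" "y \<notin> set u" "{x, a} \<in> seg u" "a \<noteq> y" "\<eta> a = \<eta> (last u)"
  shows "{if \<eta> a then y else x, a} \<in> seg (flip u)"
proof -
  note a = seg_x[OF assms(1-4)]
  have "flip u \<noteq> []" using a by (simp add: flip_def)
  then show ?thesis using a assms(5) by (auto simp: seg_eq) (auto simp: flip_def last_rev)
qed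

lemma seg_xy:
  assumes "x \<notin> set u" "y \<notin> set u" "{x, y} \<in> seg u"
  shows "u = []"
proof (rule ccontr)
  assume ne: "u \<noteq> []"
  then have "hd u \<noteq> y" "last u \<noteq> x" using assms by auto
  then show False using assms ne xy path_edges_off[of u y]
    by (auto simp: seg_eq doubleton_eq_iff)
qed

lemma seg_off: "e \<in> seg u \<Longrightarrow> x \<notin> e \<Longrightarrow> y \<notin> e \<Longrightarrow> e \<in> seg (flip u)"
  by (cases "u = []") (auto simp: seg_eq flip_def)

text \<open>Both segments are read from \<open>x\<close> to \<open>y\<close>. One may be empty, for
  a cycle that uses the edge \<open>xy\<close>; if both were, only this edge would remain.\<close>

definition through_both :: "'a set set \<Rightarrow> 'a list \<times> 'a list \<Rightarrow> bool" where
  "through_both Z u \<longleftrightarrow> distinct (x # y # fst u @ snd u) \<and> fst u @ snd u \<noteq> [] \<and>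
     Z = seg (fst u) \<union> seg (snd u)"

text \<open>The neighbour of \<open>y\<close> at the other end of the segment that begins with
  \<open>a\<close>. Its colour decides on the reversal, so \<open>a\<close> has to agree with
  it.\<close>

definition far :: "'a list \<times> 'a list \<Rightarrow> 'a \<Rightarrow> 'a" where
  "far u a = (if fst u \<noteq> [] \<and> a = hd (fst u) then last (fst u) else last (snd u))"

text \<open>The premise \<open>\<eta> a = \<eta> (f a)\<close> need only hold for one cover member through \<open>xa\<close>; the other members
  may fail to cover the image of that edge.\<close>

definition lifts :: "'a set set \<Rightarrow> ('a \<Rightarrow> 'a) \<Rightarrow> 'a set set \<Rightarrow> bool" where
  "lifts Z f Z' \<longleftrightarrow> cycle_or_edge Z' \<and> Z' \<subseteq> E \<and>
     (\<forall>e\<in>Z. x \<notin> e \<longrightarrow> y \<notin> e \<longrightarrow> e \<in> Z') \<and>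
     ({x, y} \<in> Z \<longrightarrow> {x, y} \<in> Z') \<and>
     (\<forall>s. s \<noteq> x \<longrightarrow> {y, s} \<in> Z \<longrightarrow> {if \<eta> s then x else y, s} \<in> Z') \<and>
     (\<forall>a. a \<noteq> y \<longrightarrow> {x, a} \<in> Z \<longrightarrow> \<eta> a = \<eta> (f a) \<longrightarrow> {if \<eta> a then y else x, a} \<in> Z')"

lemma cycle_seg: "cycle_edges (x # u @ y # rev v) = seg u \<union> seg v"
  using path_edges_append[of "x # u" y "rev v @ [x]"] path_edges_rev[of "x # v @ [y]"]
  by (simp add: cycle_edges_Cons seg_def)

text \<open>The two segments are flipped independently; as their vertices stay the same, the result
  is again a cycle. An empty segment is left alone, so the edge \<open>xy\<close> is not
  lost.\<close>

lemma lifts_through_both: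
  assumes "through_both Z u" "Z \<subseteq> E'"
  shows "\<exists>Z'. lifts Z (far u) Z'"
proof -
  obtain u1 u2 where u: "u = (u1, u2)" by (cases u)
  have d: "distinct (x # y # u1 @ u2)" "u1 @ u2 \<noteq> []" "Z = seg u1 \<union> seg u2"
    using assms unfolding through_both_def u by auto
  then have off1: "x \<notin> set u1" "y \<notin> set u1" and off2: "x \<notin> set u2" "y \<notin> set u2" by auto
  define Z' where "Z' = seg (flip u1) \<union> seg (flip u2)"
  have "cycle_or_edge Z'"
    unfolding Z'_def cycle_seg[symmetric] using d
    by (intro cycle_or_edge_cycle) (auto simp: Suc_le_eq)
  moreover have "Z' \<subseteq> E"
    using seg_flip_subset off1 off2 assms d unfolding Z'_def by blast
  moreover have "{x, y} \<in> Z'" if "{x, y} \<in> Z"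
    using that seg_xy off1 off2 d(3) unfolding Z'_def by (auto simp: flip_def)
  moreover have "{if \<eta> a then y else x, a} \<in> Z'"
    if a: "a \<noteq> y" "{x, a} \<in> Z" "\<eta> a = \<eta> (far u a)" for a
  proof (cases "{x, a} \<in> seg u1")
    case True
    then show ?thesis
      using seg_x[OF off1 True a(1)] seg_flip_x[OF off1 True a(1)] a(3) u
      unfolding Z'_def by (auto simp: far_def)
  next
    case False
    then have 2: "{x, a} \<in> seg u2" using a d by blast
    have "\<not> (u1 \<noteq> [] \<and> a = hd u1)" using False by (auto simp: seg_eq)
    then show ?thesis
      using seg_flip_x[OF off2 2 a(1)] a(3) u unfolding Z'_def by (auto simp: far_def)
  qed
  moreover have "{if \<eta> s then x else y, s} \<in> Z'" if "s \<noteq> x" "{y, s} \<in> Z" for s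
    using seg_flip_y off1 off2 that d(3) unfolding Z'_def by blast
  moreover have "e \<in> Z'" if "e \<in> Z" "x \<notin> e" "y \<notin> e" for e
    using seg_off that d(3) unfolding Z'_def by blast
  ultimately have "lifts Z (far u) Z'" unfolding lifts_def by blast
  then show ?thesis ..
qed

text \<open>If the ends of \<open>ws\<close> are attached to different vertices, the cycle is closed through the
  edge \<open>xy\<close>.\<close>

lemma close_path:
  assumes "distinct ws" "2 \<le> length ws" "x \<notin> set ws" "y \<notin> set ws" "path_edges ws \<subseteq> E"
    and "{p, hd ws} \<in> E" "{q, last ws} \<in> E" "p \<in> {x, y}" "q \<in> {x, y}"
  shows "\<exists>Z'. cycle_or_edge Z' \<and> Z' \<subseteq> E \<and> path_edges ws \<subseteq> Z' \<and> {p, hd ws} \<in> Z' \<and> {q, last ws} \<in> Z'"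
proof (cases "p = q")
  case True
  have ws: "ws \<noteq> []" using assms(2) by auto
  define Z' where "Z' = cycle_edges (p # ws)"
  have "cycle_or_edge Z'" unfolding Z'_def using assms by (intro cycle_or_edge_cycle) auto
  moreover have "Z' = {{p, hd ws}, {q, last ws}} \<union> path_edges ws"
    unfolding Z'_def cycle_edges_Cons using ws True by (auto simp: path_edges_Cons path_edges_snoc insert_commute)
  ultimately show ?thesis using assms by (intro exI[of _ Z']) auto
next
  case False
  have ws: "ws \<noteq> []" using assms(2) by auto
  define Z' where "Z' = cycle_edges (q # p # ws)"
  have "cycle_or_edge Z'" unfolding Z'_def using assms False by (intro cycle_or_edge_cycle) auto
  moreover have "Z' = {{p, q}, {p, hd ws}, {q, last ws}} \<union> path_edges ws"
    unfolding Z'_def cycle_edges_Cons using ws False by (auto simp: path_edges_Cons path_edges_snoc insert_commute)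
  moreover have "{p, q} \<in> E" using assms False xy by (auto simp: insert_commute)
  ultimately show ?thesis using assms by (intro exI[of _ Z']) auto
qed

text \<open>Here every attachment to \<open>x\<close> or \<open>y\<close> can be chosen separately:
  a single edge is moved by itself, and a cycle through just one of the two vertices is reassembled
  by \<open>close_path\<close>. Hence no colours need to agree, and the identity serves as
  \<open>f\<close>.\<close>

lemma lifts_not_through_both:
  assumes "cycle_or_edge Z" "Z \<subseteq> E'" "\<not> (\<exists>u. through_both Z u)"
  shows "\<exists>Z'. lifts Z (\<lambda>a. a) Z'"
  using assms(1)
proof (cases rule: cycle_or_edge_cases)
  case (edge u v)
  have "x \<in> {u, v} \<or> y \<in> {u, v} \<or> {u, v} \<inter> {x, y} = {}" by blast
  then consider "{u, v} = {x, y}" | w where "{u, v} = {x, w}" "w \<noteq> y" "w \<noteq> x"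
    | w where "{u, v} = {y, w}" "w \<noteq> x" "w \<noteq> y" | "{u, v} \<inter> {x, y} = {}"
    using edge(1) by (metis doubleton_eq_iff insertE singletonD)
  then show ?thesis
  proof cases
    case 1
    then have "lifts Z (\<lambda>a. a) {{x, y}}"
      unfolding lifts_def using edge xy cycle_or_edge_single[of x y] by (auto simp: doubleton_eq_iff)
    then show ?thesis ..
  next
    case 2
    then have Z: "Z = {{x, w}}" "{x, w} \<in> E'" using edge assms(2) by auto
    have "lifts Z (\<lambda>a. a) {{if \<eta> w then y else x, w}}"
      unfolding lifts_def Z(1) using 2 Z(2) xy at_x[of w]
        cycle_or_edge_single[of x w] cycle_or_edge_single[of y w]
      by (auto simp: doubleton_eq_iff)
    then show ?thesis ..
  next
    case 3
    then have Z: "Z = {{y, w}}" "{y, w} \<in> E'" using edge assms(2) by auto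
    have "lifts Z (\<lambda>a. a) {{if \<eta> w then x else y, w}}"
      unfolding lifts_def Z(1) using 3 Z(2) xy at_y[of w]
        cycle_or_edge_single[of x w] cycle_or_edge_single[of y w]
      by (auto simp: doubleton_eq_iff)
    then show ?thesis ..
  next
    case 4
    then have "lifts Z (\<lambda>a. a) Z"
      unfolding lifts_def using edge xy off assms(1,2) by (auto simp: doubleton_eq_iff)
    then show ?thesis ..
  qed
next
  case (cycle vs)
  have Z_at: "\<exists>ws. distinct (v # ws) \<and> 2 \<le> length ws \<and> Z = cycle_edges (v # ws) \<and> set vs = set (v # ws)"
    if v: "v \<in> set vs" for v
  proof -
    obtain p r where "vs = p @ v # r" using v by (meson split_list)
    then show ?thesis
      using cycle cycle_edges_rotate[of p "v # r"] by (intro exI[of _ "r @ p"]) auto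
  qed
  show ?thesis
  proof (cases "x \<in> set vs")
    case True
    then obtain ws where ws: "distinct (x # ws)" "2 \<le> length ws" "Z = cycle_edges (x # ws)"
      "set vs = set (x # ws)" using Z_at by blast
    have "y \<notin> set ws"
    proof
      assume "y \<in> set ws"
      then obtain p r where pr: "ws = p @ y # r" by (meson split_list)
      then have "p @ rev r \<noteq> []" using ws(2) by auto
      \<comment> \<open>The cycle runs through its second arc from \<open>y\<close> to
        \<open>x\<close>, whereas segments are read from \<open>x\<close> to
        \<open>y\<close>.\<close>
      then have "through_both Z (p, rev r)"
        using ws cycle_seg[of p "rev r"] pr unfolding through_both_def by auto
      with assms(3) show False by blast
    qed
    have ne: "ws \<noteq> []" using ws(2) by auto
    note Z = cycle_edges_closed[OF ne, of x, folded ws(3)]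
    have offx: "x \<notin> set ws" using ws by auto
    have ends: "hd ws \<noteq> x" "hd ws \<noteq> y" "last ws \<noteq> x" "last ws \<noteq> y"
      using ne offx \<open>y \<notin> set ws\<close> by auto
    have "path_edges ws \<subseteq> E" "{if \<eta> (hd ws) then y else x, hd ws} \<in> E" "{if \<eta> (last ws) then y else x, last ws} \<in> E"
      using path_edges_lift[of ws] offx \<open>y \<notin> set ws\<close> Z assms(2) at_x[of "hd ws"] at_x[of "last ws"] ends by auto
    then have "\<exists>Z'. cycle_or_edge Z' \<and> Z' \<subseteq> E \<and> path_edges ws \<subseteq> Z' \<and> {if \<eta> (hd ws) then y else x, hd ws} \<in> Z' \<and> {if \<eta> (last ws) then y else x, last ws} \<in> Z'"
      using ws(1,2) offx \<open>y \<notin> set ws\<close> by (intro close_path) auto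
    then obtain Z' where "cycle_or_edge Z'" "Z' \<subseteq> E" "path_edges ws \<subseteq> Z'"
      "{if \<eta> (hd ws) then y else x, hd ws} \<in> Z'" "{if \<eta> (last ws) then y else x, last ws} \<in> Z'" by blast
    then have "lifts Z (\<lambda>a. a) Z'"
      unfolding lifts_def using Z ends path_edges_off[OF offx \<open>y \<notin> set ws\<close>]
      by (auto simp: doubleton_eq_iff)
    then show ?thesis ..
  next
    case offx: False
    show ?thesis
    proof (cases "y \<in> set vs")
      case True
      then obtain ws where ws: "distinct (y # ws)" "2 \<le> length ws" "Z = cycle_edges (y # ws)"
        "set vs = set (y # ws)" using Z_at by blast
      have ne: "ws \<noteq> []" using ws(2) by auto
      note Z = cycle_edges_closed[OF ne, of y, folded ws(3)]
      have offy: "x \<notin> set ws" "y \<notin> set ws" using ws offx by auto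
      have ends: "hd ws \<noteq> x" "hd ws \<noteq> y" "last ws \<noteq> x" "last ws \<noteq> y"
        using ne offy by auto
      have "path_edges ws \<subseteq> E" "{if \<eta> (hd ws) then x else y, hd ws} \<in> E" "{if \<eta> (last ws) then x else y, last ws} \<in> E"
        using path_edges_lift[of ws] offy Z assms(2) at_y[of "hd ws"] at_y[of "last ws"] ends by auto
      then have "\<exists>Z'. cycle_or_edge Z' \<and> Z' \<subseteq> E \<and> path_edges ws \<subseteq> Z' \<and> {if \<eta> (hd ws) then x else y, hd ws} \<in> Z' \<and> {if \<eta> (last ws) then x else y, last ws} \<in> Z'"
        using ws(1,2) offy by (intro close_path) auto
      then obtain Z' where "cycle_or_edge Z'" "Z' \<subseteq> E" "path_edges ws \<subseteq> Z'"
        "{if \<eta> (hd ws) then x else y, hd ws} \<in> Z'" "{if \<eta> (last ws) then x else y, last ws} \<in> Z'" by blast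
      then have "lifts Z (\<lambda>a. a) Z'"
        unfolding lifts_def using Z ends path_edges_off[OF offy]
        by (auto simp: doubleton_eq_iff)
      then show ?thesis ..
    next
      case False
      have "\<Union>Z = set vs" using Union_cycle_edges[of vs] cycle by auto
      then have "x \<notin> e" "y \<notin> e" if "e \<in> Z" for e using that offx False by blast+
      then have "lifts Z (\<lambda>a. a) Z"
        unfolding lifts_def using off assms(1,2) by blast
      then show ?thesis ..
    qed
  qed
qed

end

section \<open>Transfer of a cover along one shift\<close>

definition kelmans_shift :: "'a \<Rightarrow> 'a \<Rightarrow> 'a set set \<Rightarrow> 'a set set" where
  "kelmans_shift x y E = (let B = {b. {x, b} \<in> E \<and> {y, b} \<notin> E \<and> b \<noteq> y} in
     (E - (\<lambda>b. {x, b}) ` B) \<union> (\<lambda>b. {y, b}) ` B)"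

text \<open>Only one member \<open>X a\<close> has to cover the image of \<open>xa\<close>, so each
  common neighbour \<open>a\<close> of \<open>x\<close> and \<open>y\<close> yields at most one
  condition: to share the colour of a single vertex. Such conditions form a function, and
  \<open>colouring_along_function\<close> meets them.\<close>

lemma coverable_kelmans_shift:
  assumes E: "\<And>e. e \<in> E \<Longrightarrow> card e = 2" and xy: "{x, y} \<in> E"
    and cov: "coverable (kelmans_shift x y E) k"
  shows "coverable E k"
proof -
  define B where "B = {b. {x, b} \<in> E \<and> {y, b} \<notin> E \<and> b \<noteq> y}"
  define E' where "E' = (E - (\<lambda>b. {x, b}) ` B) \<union> (\<lambda>b. {y, b}) ` B"
  have E'_eq: "kelmans_shift x y E = E'"
    unfolding kelmans_shift_def E'_def B_def Let_def ..
  have "x \<noteq> y" using E[OF xy] by auto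
  have loop: "{v, v} \<notin> E" for v using E[of "{v, v}"] by auto
  have "y \<notin> B" "x \<notin> B" unfolding B_def using loop by auto
  then have img: "{y, s} \<notin> (\<lambda>b. {x, b}) ` B" "{y, s} \<in> (\<lambda>b. {y, b}) ` B \<longleftrightarrow> s \<in> B"
    "{x, s} \<in> (\<lambda>b. {x, b}) ` B \<longleftrightarrow> s \<in> B" "s \<noteq> y \<Longrightarrow> {x, s} \<notin> (\<lambda>b. {y, b}) ` B" for s
    using \<open>x \<noteq> y\<close> by (auto simp: image_iff doubleton_eq_iff)
  have E'_y: "{y, s} \<in> E' \<longleftrightarrow> {y, s} \<in> E \<or> s \<in> B" for s
    by (simp add: E'_def img)
  have E'_x: "{x, a} \<in> E' \<longleftrightarrow> {x, a} \<in> E \<and> a \<notin> B" if "a \<noteq> y" for a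
    using that by (simp add: E'_def img)
  have E'_off: "e \<in> E' \<longleftrightarrow> e \<in> E" if "x \<notin> e" "y \<notin> e" for e
    using that unfolding E'_def by auto
  obtain Es where Es: "ce_cover E' Es" "length Es \<le> k"
    using cov unfolding E'_eq coverable_def by blast
  define A where "A = {a. {x, a} \<in> E \<and> {y, a} \<in> E}"
  have "\<forall>a\<in>A. \<exists>Z\<in>set Es. {x, a} \<in> Z"
  proof
    fix a assume "a \<in> A"
    moreover from this have "a \<noteq> y" using loop[of y] unfolding A_def by auto
    ultimately have "{x, a} \<in> E'" using E'_x[of a] unfolding A_def B_def by auto
    then show "\<exists>Z\<in>set Es. {x, a} \<in> Z" using Es(1) unfolding ce_cover_iff by blast
  qed
  then obtain X where X: "\<And>a. a \<in> A \<Longrightarrow> X a \<in> set Es \<and> {x, a} \<in> X a" by metis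
  let ?thr = "lifting.through_both x y" and ?far = "lifting.far"
  \<comment> \<open>The value of \<open>far\<close> depends on how a cycle is written as two
    segments, so one choice is fixed for each member.\<close>
  define rep where "rep Z = (SOME u. ?thr Z u)" for Z
  have rep: "?thr Z (rep Z)" if "?thr Z u" for Z u
    unfolding rep_def using that by (rule someI)
  \<comment> \<open>Members that do not pass through both vertices impose no condition, by
    \<open>lifts_not_through_both\<close>.\<close>
  define D where "D = {a \<in> A. \<exists>u. ?thr (X a) u}"
  have "D \<inter> B = {}" unfolding D_def A_def B_def by auto
  then obtain \<eta> where \<eta>: "\<And>b. b \<in> B \<Longrightarrow> \<eta> b" "\<And>c. c \<notin> D \<Longrightarrow> c \<notin> B \<Longrightarrow> \<not> \<eta> c"
    "\<And>a. a \<in> D \<Longrightarrow> \<eta> a = \<eta> (?far (rep (X a)) a)"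
    using colouring_along_function[where f = "\<lambda>a. ?far (rep (X a)) a"] by metis
  \<comment> \<open>The colour true occurs only in \<open>D\<close> and \<open>B\<close>, and both
    consist of neighbours of \<open>x\<close> in \<open>E\<close>.\<close>
  have \<eta>_x: "{x, s} \<in> E" if "\<eta> s" for s
    using that \<eta>(2)[of s] unfolding B_def D_def A_def by auto
  interpret lifting x y E E' \<eta>
  proof
    show "{if \<eta> s then x else y, s} \<in> E" if "s \<noteq> x" "{y, s} \<in> E'" for s
      using that \<eta>_x \<eta>(1) E'_y by auto
    show "{x, a} \<in> E \<and> {y, a} \<in> E" if "a \<noteq> y" "{x, a} \<in> E'" for a
      using that E'_x[of a] unfolding B_def by auto
  qed (use xy \<open>x \<noteq> y\<close> E'_off in auto)
  have "\<forall>Z\<in>set Es. \<exists>Z'. lifts Z (if \<exists>u. ?thr Z u then ?far (rep Z) else (\<lambda>a. a)) Z'"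
    using lifts_through_both lifts_not_through_both rep Es(1)
    unfolding ce_cover_iff by simp blast
  then obtain g where g: "\<And>Z. Z \<in> set Es \<Longrightarrow>
      lifts Z (if \<exists>u. ?thr Z u then ?far (rep Z) else (\<lambda>a. a)) (g Z)" by metis
  have gy: "{if \<eta> s then x else y, s} \<in> \<Union>(g ` set Es)" if "{y, s} \<in> E'" "s \<noteq> x" for s
    using that g Es(1) unfolding ce_cover_iff lifts_def by blast
  have gx: "{if \<eta> a then y else x, a} \<in> \<Union>(g ` set Es)" if a: "a \<in> A" for a
  proof -
    have "\<eta> a = \<eta> ((if \<exists>u. ?thr (X a) u then ?far (rep (X a)) else (\<lambda>a. a)) a)"
      using \<eta>(3)[of a] a unfolding D_def by auto
    moreover have "a \<noteq> y" using a loop unfolding A_def by auto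
    ultimately show ?thesis
      using X[OF a] g[of "X a"] unfolding lifts_def by blast
  qed
  \<comment> \<open>For a common neighbour \<open>s\<close>, the images of \<open>xs\<close> and
    \<open>ys\<close> are these two edges again, exchanged if \<open>\<eta> s\<close>; for
    \<open>b\<close> in \<open>B\<close>, the image of \<open>yb\<close> is
    \<open>xb\<close>.\<close>
  have "E \<subseteq> \<Union>(g ` set Es)"
  proof
    fix e assume e: "e \<in> E"
    have ex: "\<exists>s. e = {v, s} \<and> s \<noteq> v" if "v \<in> e" for v
      using E[OF e] that unfolding card_2_iff by auto
    consider "e = {x, y}" | s where "e = {y, s}" "s \<noteq> x" | s where "e = {x, s}" "s \<noteq> y"
      | "x \<notin> e" "y \<notin> e"
      using ex by (metis insert_commute)
    then show "e \<in> \<Union>(g ` set Es)"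
    proof cases
      case 1
      have "{x, y} \<in> E'" using E'_y[of x] xy by (simp add: insert_commute)
      then show ?thesis using g Es(1) 1 unfolding ce_cover_iff lifts_def by blast
    next
      case 2
      show ?thesis
      proof (cases "\<eta> s")
        case True
        then have "s \<in> A" using \<eta>_x e 2 unfolding A_def by auto
        then show ?thesis using gx[of s] True 2 by auto
      next
        case False
        then show ?thesis using gy[of s] 2 e E'_y by auto
      qed
    next
      case 3
      show ?thesis
      proof (cases "s \<in> B")
        case True
        then show ?thesis using gy[of s] \<eta>(1)[of s] 3 E'_y \<open>x \<notin> B\<close> by auto
      next
        case False
        then have s: "s \<in> A" using 3 e unfolding A_def B_def by auto
        then have "{y, s} \<in> E'" "s \<noteq> x" using E'_y loop unfolding A_def by auto
        then show ?thesis using gx[OF s] gy[of s] 3 by (cases "\<eta> s") auto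
      qed
    next
      case 4
      then have "e \<in> E'" using E'_off e by auto
      then show ?thesis using g Es(1) 4 unfolding ce_cover_iff lifts_def by blast
    qed
  qed
  moreover have "cycle_or_edge (g Z) \<and> g Z \<subseteq> E" if "Z \<in> set Es" for Z
    using g[OF that] unfolding lifts_def by blast
  ultimately have "ce_cover E (map g Es)"
    unfolding ce_cover_iff by auto
  then show ?thesis using Es(2) unfolding coverable_def by (intro exI[of _ "map g Es"]) simp
qed

section \<open>Path decompositions with prescribed ends\<close>

definition degree :: "'a set set \<Rightarrow> 'a \<Rightarrow> nat" where
  "degree E v = card {e \<in> E. v \<in> e}"

text \<open>A decomposition of the edge set into paths indexed by \<open>K\<close>; a path may be a single vertex.
  Each path is stored with both orientations, so that the path ends are the heads \<open>hd (Q j)\<close> with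
  \<open>j \<in> K \<times> UNIV\<close>.\<close>

definition path_decomposition ::
    "'a set \<Rightarrow> 'a set set \<Rightarrow> 'i set \<Rightarrow> ('i \<times> bool \<Rightarrow> 'a list) \<Rightarrow> bool" where
  "path_decomposition W E K Q \<longleftrightarrow>
     (\<forall>i\<in>K. \<forall>b. Q (i, \<not> b) = rev (Q (i, b)) \<and> Q (i, b) \<noteq> [] \<and> distinct (Q (i, b)) \<and>
        set (Q (i, b)) \<subseteq> W \<and> path_edges (Q (i, b)) \<subseteq> E) \<and>
     (\<forall>e\<in>E. \<exists>!i. i \<in> K \<and> e \<in> path_edges (Q (i, True)))"

lemma path_decompositionD:
  assumes "path_decomposition W E K Q" "i \<in> K"
  shows "Q (i, \<not> b) = rev (Q (i, b))" "Q (i, b) \<noteq> []" "distinct (Q (i, b))"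
    "set (Q (i, b)) \<subseteq> W" "path_edges (Q (i, b)) \<subseteq> E"
  using assms unfolding path_decomposition_def by blast+

lemma path_decomposition_ex1:
  "path_decomposition W E K Q \<Longrightarrow> e \<in> E \<Longrightarrow> \<exists>!i. i \<in> K \<and> e \<in> path_edges (Q (i, True))"
  unfolding path_decomposition_def by blast

text \<open>Ends are counted with multiplicity: a one-vertex path contributes two at its
  vertex.\<close>

definition ends :: "'i set \<Rightarrow> ('i \<times> bool \<Rightarrow> 'a list) \<Rightarrow> 'a \<Rightarrow> nat" where
  "ends K Q v = card {j \<in> K \<times> UNIV. hd (Q j) = v}"

lemma path_edges_orientation:
  assumes "path_decomposition W E K Q" "i \<in> K"
  shows "path_edges (Q (i, b)) = path_edges (Q (i, True))"
proof (cases b)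
  case False
  have "Q (i, \<not> True) = rev (Q (i, True))"
    using assms unfolding path_decomposition_def by blast
  then show ?thesis using False by simp
qed simp

text \<open>The new path keeps the other end of the old one, so just one end moves. Adding to both
  sides of the count avoids truncated subtraction and includes the case that the end does not
  change.\<close>

lemma replace_path:
  assumes Q: "path_decomposition W E K Q" and K: "finite K" and i: "i \<in> K"
    and P: "P \<noteq> []" "distinct P" "set P \<subseteq> W" "last P = last (Q (i, b))"
    and new: "path_edges P \<inter> (E - path_edges (Q (i, b))) = {}"
  defines "Q' \<equiv> Q((i, b) := P, (i, \<not> b) := rev P)"
  shows "path_decomposition W ((E - path_edges (Q (i, b))) \<union> path_edges P) K Q'"
    and "\<And>v. ends K Q' v + of_bool (hd (Q (i, b)) = v) = ends K Q v + of_bool (hd P = v)"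
    and "\<And>j. j \<in> K \<times> UNIV \<Longrightarrow> j \<noteq> (i, b) \<Longrightarrow> hd (Q' j) = hd (Q j)"
proof -
  have Q'_i: "Q' (i, c) = (if c = b then P else rev P)" for c
    unfolding Q'_def by auto
  have Q'_other: "Q' (i', c) = Q (i', c)" if "i' \<noteq> i" for i' c
    unfolding Q'_def using that by auto
  have other_end: "Q (i, \<not> b) = rev (Q (i, b))" "Q (i, b) \<noteq> []"
    using path_decompositionD[OF Q i] by blast+
  have edges_i: "path_edges (Q' (i, c)) = path_edges P" for c
    using Q'_i by auto
  have edges_other: "path_edges (Q (i', c)) \<inter> path_edges (Q (i, b)) = {}" if i': "i' \<noteq> i" "i' \<in> K" for i' c
  proof (rule ccontr)
    assume "path_edges (Q (i', c)) \<inter> path_edges (Q (i, b)) \<noteq> {}"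
    then obtain e where "e \<in> path_edges (Q (i', True))" "e \<in> path_edges (Q (i, True))"
      using path_edges_orientation[OF Q i'(2), of c] path_edges_orientation[OF Q i, of b] by auto
    moreover from this have "e \<in> E" using path_decompositionD(5)[OF Q i] by blast
    ultimately show False using path_decomposition_ex1[OF Q, of e] i i' by blast
  qed
  show hd_same: "hd (Q' j) = hd (Q j)" if "j \<in> K \<times> UNIV" "j \<noteq> (i, b)" for j
  proof (cases "fst j = i")
    case True
    then have "j = (i, \<not> b)" using that by (cases j) auto
    then show ?thesis using Q'_i other_end P by (simp add: hd_rev)
  next
    case False
    then show ?thesis using Q'_other[of "fst j" "snd j"] by simp
  qed
  show "path_decomposition W ((E - path_edges (Q (i, b))) \<union> path_edges P) K Q'"
    unfolding path_decomposition_def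
  proof (intro conjI ballI allI)
    fix i' c assume i': "i' \<in> K"
    note Qi' = path_decompositionD[OF Q i', of c]
    show "Q' (i', \<not> c) = rev (Q' (i', c))" "Q' (i', c) \<noteq> []" "distinct (Q' (i', c))"
      "set (Q' (i', c)) \<subseteq> W"
      using Qi' P Q'_i Q'_other by (cases "i' = i"; auto)+
    show "path_edges (Q' (i', c)) \<subseteq> E - path_edges (Q (i, b)) \<union> path_edges P"
    proof (cases "i' = i")
      case False
      have "path_edges (Q (i', c)) \<subseteq> E - path_edges (Q (i, b))"
        using Qi'(5) edges_other[OF False i', of c] by blast
      then show ?thesis unfolding Q'_other[OF False] by blast
    next
      case True
      then show ?thesis by (simp add: edges_i)
    qed
  next
    fix e assume e: "e \<in> E - path_edges (Q (i, b)) \<union> path_edges P"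
    show "\<exists>!i. i \<in> K \<and> e \<in> path_edges (Q' (i, True))"
    proof (cases "e \<in> path_edges P")
      case True
      have "e \<notin> path_edges (Q' (i', True))" if "i' \<in> K" "i' \<noteq> i" for i'
      proof
        assume "e \<in> path_edges (Q' (i', True))"
        then have "e \<in> path_edges (Q (i', True))" using Q'_other that by simp
        moreover from this have "e \<in> E" using path_decompositionD(5)[OF Q that(1)] by blast
        ultimately show False using True new edges_other[OF that(2,1)] by blast
      qed
      then show ?thesis using True i edges_i by blast
    next
      case False
      then have e': "e \<in> E" "e \<notin> path_edges (Q (i, True))"
        using e path_edges_orientation[OF Q i] by blast+
      from path_decomposition_ex1[OF Q this(1)]
      obtain i1 where i1: "i1 \<in> K" "e \<in> path_edges (Q (i1, True))"
        "\<And>i2. i2 \<in> K \<Longrightarrow> e \<in> path_edges (Q (i2, True)) \<Longrightarrow> i2 = i1"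
        by (elim ex1E) blast
      show ?thesis
      proof (rule ex1I[of _ i1])
        have "i1 \<noteq> i" using i1(2) e'(2) by blast
        then show "i1 \<in> K \<and> e \<in> path_edges (Q' (i1, True))"
          using i1(1,2) by (simp add: Q'_other)
        show "i2 = i1" if i2: "i2 \<in> K \<and> e \<in> path_edges (Q' (i2, True))" for i2
        proof (cases "i2 = i")
          case True
          then show ?thesis using i2 False by (simp add: edges_i)
        next
          case neq: False
          then show ?thesis using i2 i1(3)[of i2] by (simp add: Q'_other)
        qed
      qed
    qed
  qed
  show "ends K Q' v + of_bool (hd (Q (i, b)) = v) = ends K Q v + of_bool (hd P = v)" for v
  proof -
    let ?J = "K \<times> (UNIV :: bool set)" and ?j = "(i, b)"
    have split: "ends K R v = card {j \<in> ?J - {?j}. hd (R j) = v} + of_bool (hd (R ?j) = v)" for R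
    proof -
      have "{j \<in> ?J. hd (R j) = v} =
        {j \<in> ?J - {?j}. hd (R j) = v} \<union> (if hd (R ?j) = v then {?j} else {})"
        using i by auto
      moreover have "finite {j \<in> ?J - {?j}. hd (R j) = v}" using K by auto
      ultimately show ?thesis unfolding ends_def by (auto simp: card_insert_if)
    qed
    have "hd (Q' j) = hd (Q j)" if "j \<in> ?J - {?j}" for j
      using hd_same[of j] that by blast
    then have "{j \<in> ?J - {?j}. hd (Q' j) = v} = {j \<in> ?J - {?j}. hd (Q j) = v}"
      by (intro Collect_cong conj_cong refl) simp
    moreover have "Q' ?j = P" using Q'_i by simp
    ultimately show ?thesis using split[of Q] split[of Q'] by simp
  qed
qed

text \<open>The edge \<open>cy\<close> is added to a decomposition. The path with designated end \<open>y\<close> is prolonged to \<open>c\<close>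
  if it avoids \<open>c\<close>; otherwise it has an edge \<open>zc\<close> on the side of \<open>y\<close>, and \<open>cy\<close> replaces \<open>zc\<close> in it,
  so that \<open>cz\<close> remains to be added. Then \<open>y\<close> is dropped from the set \<open>F\<close> of vertices with a
  designated end, and the process stops.\<close>

lemma add_edge:
  assumes "finite K" "finite F" "path_decomposition W (E - {{c, y}}) K Q" "{c, y} \<in> E"
    and "y \<in> F" "c \<notin> F" "c \<in> W"
    and "\<And>v. v \<in> F \<Longrightarrow> d v \<in> K \<times> UNIV \<and> hd (Q (d v)) = v"
    and "\<And>v p z r. v \<in> F \<Longrightarrow> Q (d v) = p @ z # c # r \<Longrightarrow> z \<in> F"
  shows "\<exists>Q'. path_decomposition W E K Q' \<and>
    (\<forall>v. ends K Q' v + of_bool (y = v) = ends K Q v + of_bool (c = v))"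
  using assms(2-)
proof (induction "card F" arbitrary: F y Q rule: less_induct)
  case less
  note Q = less.prems(2)
  obtain i b where ib: "d y = (i, b)" by (cases "d y")
  define P where "P = Q (i, b)"
  have i: "i \<in> K" and hdP: "hd P = y" using less.prems(7)[of y] less.prems(4) ib P_def by auto
  have P: "P \<noteq> []" "distinct P" "set P \<subseteq> W" "path_edges P \<subseteq> E - {{c, y}}"
    and revP: "Q (i, \<not> b) = rev P"
    using path_decompositionD[OF Q i] unfolding P_def by blast+
  have "y \<noteq> c" using less.prems by auto
  show ?case
  proof (cases "c \<in> set P")
    case False
    have edges: "path_edges (c # P) = insert {c, y} (path_edges P)"
      using P hdP by (simp add: path_edges_Cons)
    have "E - {{c, y}} - path_edges P \<union> path_edges (c # P) = E"
      using edges P(4) less.prems(3) by auto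
    then have "path_decomposition W E K (Q((i, b) := c # P, (i, \<not> b) := rev (c # P))) \<and>
      (\<forall>v. ends K (Q((i, b) := c # P, (i, \<not> b) := rev (c # P))) v + of_bool (y = v) =
        ends K Q v + of_bool (c = v))"
      using replace_path(1,2)[OF Q assms(1) i, of "c # P" b] P hdP False edges less.prems(6)
      unfolding P_def[symmetric] by auto
    then show ?thesis by blast
  next
    case True
    then obtain p' r where "P = p' @ c # r" by (meson split_list)
    moreover from this have "p' \<noteq> []" using hdP \<open>y \<noteq> c\<close> by auto
    ultimately obtain p z where Pp: "P = p @ z # c # r"
      by (metis append.assoc append_Cons append_Nil append_butlast_last_id)
    have edgesP: "path_edges P = path_edges (p @ [z]) \<union> insert {z, c} (path_edges (c # r))"
      unfolding Pp using path_edges_append[of p z "c # r"] by simp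
    \<comment> \<open>The initial part up to \<open>z\<close> is turned round: the path now starts
      at \<open>z\<close>, and \<open>y\<close> is joined to \<open>c\<close>.\<close>
    define P' where "P' = rev (p @ [z]) @ c # r"
    have hd_pz: "hd (p @ [z]) = y" using hdP unfolding Pp by (cases p) auto
    have edgesP': "path_edges P' = path_edges (p @ [z]) \<union> insert {y, c} (path_edges (c # r))"
      unfolding P'_def using path_edges_append[of "rev (p @ [z])" c r]
        path_edges_snoc[of "rev (p @ [z])" c] path_edges_rev[of "p @ [z]"] hd_pz
      by (simp add: last_rev del: rev_append path_edges_rev)
    have z: "z \<in> F" using less.prems(8)[OF less.prems(4), of p z r] ib P_def Pp by simp
    have zc: "{z, c} \<in> E" "{z, c} \<noteq> {c, y}" using edgesP P(4) by auto
    then have "z \<noteq> y" by (auto simp: insert_commute)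
    have zc_old: "{z, c} \<notin> path_edges (p @ [z])" "{z, c} \<notin> path_edges (c # r)"
      using path_edges_subset[of "{z, c}"] P(2) unfolding Pp by fastforce+
    define Q1 where "Q1 = Q((i, b) := P', (i, \<not> b) := rev P')"
    have eq: "E - {{c, y}} - path_edges P \<union> path_edges P' = E - {{c, z}}"
      using edgesP edgesP' zc zc_old P(4) less.prems(3) by (auto simp: insert_commute)
    have "path_edges P' \<inter> (E - {{c, y}} - path_edges P) = {}"
      using edgesP edgesP' by (auto simp: insert_commute)
    moreover have "P' \<noteq> []" "distinct P'" "set P' \<subseteq> W" "last P' = last P" "hd P' = z"
      using P unfolding P'_def Pp by auto
    ultimately have Q1: "path_decomposition W (E - {{c, z}}) K Q1"
      and ends1: "\<And>v. ends K Q1 v + of_bool (y = v) = ends K Q v + of_bool (z = v)"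
      and hd1: "\<And>j. j \<in> K \<times> UNIV \<Longrightarrow> j \<noteq> (i, b) \<Longrightarrow> hd (Q1 j) = hd (Q j)"
      using replace_path[OF Q assms(1) i, of P' b] hdP eq
      unfolding P_def[symmetric] Q1_def by auto
    have d1: "d v \<noteq> (i, b)" if "v \<in> F - {y}" for v
      using less.prems(7)[of v] that hdP unfolding P_def by auto
    \<comment> \<open>The modified path, read from its other end, still has the same vertex before
      \<open>c\<close>; all other designated paths are unchanged. This vertex is not
      \<open>y\<close>, because the old paths avoid the edge \<open>cy\<close>.\<close>
    have pred1: "z' \<in> F - {y}" if v: "v \<in> F - {y}" and Qv: "Q1 (d v) = p' @ z' # c # r'" for v p' z' r'
    proof -
      have "\<exists>r''. Q (d v) = p' @ z' # c # r''"
      proof (cases "d v = (i, \<not> b)")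
        case True
        then have "rev r @ c # (p @ [z]) = (p' @ [z']) @ c # r'"
          using Qv unfolding Q1_def P'_def by simp
        moreover have "c \<notin> set (rev r)" "c \<notin> set (p @ [z])" using P(2) unfolding Pp by auto
        ultimately have "rev r = p' @ [z']" using append_Cons_eq_iff by metis
        then have "Q (d v) = p' @ z' # c # z # rev p" using revP True unfolding Pp by simp
        then show ?thesis by blast
      next
        case False
        then show ?thesis using Qv d1[OF v] unfolding Q1_def by auto
      qed
      then obtain r'' where r'': "Q (d v) = p' @ z' # c # r''" ..
      then have "{z', c} \<in> path_edges (Q (d v))"
        using path_edges_append[of p' z' "c # r''"] by simp
      moreover have "path_edges (Q (d v)) \<subseteq> E - {{c, y}}"
        using less.prems(7)[of v] v path_decompositionD(5)[OF Q] by (cases "d v") auto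
      ultimately show ?thesis using less.prems(8)[of v] v r'' by (auto simp: insert_commute)
    qed
    have "\<exists>Q'. path_decomposition W E K Q' \<and>
      (\<forall>v. ends K Q' v + of_bool (z = v) = ends K Q1 v + of_bool (c = v))"
    proof (rule less.hyps[of "F - {y}"])
      show "card (F - {y}) < card F" using less.prems(1,4) by (meson card_Diff1_less)
      show "d v \<in> K \<times> UNIV \<and> hd (Q1 (d v)) = v" if "v \<in> F - {y}" for v
        using less.prems(7)[of v] hd1 d1[OF that] that by auto
      show "path_decomposition W (E - {{c, z}}) K Q1" by (rule Q1)
      show "{c, z} \<in> E" using zc(1) by (simp add: insert_commute)
      show "z' \<in> F - {y}" if "v \<in> F - {y}" "Q1 (d v) = p' @ z' # c # r'" for v p' z' r'
        using pred1 that .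
    qed (use less.prems(1,5,6) z \<open>z \<noteq> y\<close> in auto)
    then obtain Q' where Q': "path_decomposition W E K Q'"
      "\<And>v. ends K Q' v + of_bool (z = v) = ends K Q1 v + of_bool (c = v)" by blast
    \<comment> \<open>The end gained at \<open>z\<close> by the rotation is the one that inserting
      \<open>cz\<close> takes away.\<close>
    have "ends K Q' v + of_bool (y = v) = ends K Q v + of_bool (c = v)" for v
      using Q'(2)[of v] ends1[of v] by linarith
    with Q'(1) show ?thesis by blast
  qed
qed

section \<open>Existence of decompositions with prescribed ends\<close>

lemma degree_remove:
  assumes "finite E" "{c, u} \<in> E"
  shows "degree E v = degree (E - {{c, u}}) v + of_bool (v = c \<or> v = u)"
proof -
  have "{e \<in> E. v \<in> e} = {e \<in> E - {{c, u}}. v \<in> e} \<union> (if v = c \<or> v = u then {{c, u}} else {})"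
    using assms by auto
  moreover have "finite {e \<in> E - {{c, u}}. v \<in> e}" using assms by auto
  ultimately show ?thesis unfolding degree_def by (auto simp: card_insert_if)
qed

lemma degree_pos: "finite E \<Longrightarrow> e \<in> E \<Longrightarrow> v \<in> e \<Longrightarrow> 0 < degree E v"
  unfolding degree_def by (auto simp: card_gt_0_iff)

text \<open>Induction on the number of edges: an edge \<open>cu\<close> is taken out, the demand at
  \<open>u\<close> raised and that at \<open>c\<close> lowered by one; \<open>add_edge\<close> puts
  \<open>cu\<close> back and moves one end from \<open>u\<close> to \<open>c\<close>.\<close>

lemma path_decomposition_exists:
  fixes n :: "'a \<Rightarrow> nat"
  assumes "finite W" "\<And>e. e \<in> E \<Longrightarrow> e \<subseteq> W \<and> card e = 2"
    and "\<And>v. v \<in> W \<Longrightarrow> even (n v + degree E v)"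
    and "\<And>u v. u \<in> W \<Longrightarrow> v \<in> W \<Longrightarrow> n u = 0 \<Longrightarrow> n v = 0 \<Longrightarrow> 0 < degree E u \<Longrightarrow> 0 < degree E v \<Longrightarrow> u = v"
  shows "\<exists>(K :: ('a \<times> nat) set) Q. finite K \<and> path_decomposition W E K Q \<and> (\<forall>v\<in>W. ends K Q v = n v)"
  using assms(2-)
proof (induction "card E" arbitrary: E n rule: less_induct)
  case less
  have finE: "finite E" using less.prems(1) assms(1) by (meson finite_Pow_iff finite_subset PowI subsetI)
  show ?case
  proof (cases "E = {}")
    case True
    \<comment> \<open>All degrees vanish, so \<open>n v\<close> is even, and half as many one-vertex
      paths at \<open>v\<close> supply it. Hence the index type
      \<open>'a \<times> nat\<close>.\<close>
    define K where "K = Sigma W (\<lambda>v. {..<n v div 2})"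
    define Q where "Q = (\<lambda>((v, k :: nat), b :: bool). [v :: 'a])"
    have "path_decomposition W E K Q"
      unfolding path_decomposition_def K_def Q_def True by auto
    moreover have "ends K Q v = n v" if "v \<in> W" for v
    proof -
      have "{j \<in> K \<times> UNIV. hd (Q j) = v} = ({v} \<times> {..<n v div 2}) \<times> (UNIV :: bool set)"
        using that unfolding K_def Q_def by auto
      moreover have "even (n v)" using less.prems(2)[OF that] True unfolding degree_def by simp
      ultimately show ?thesis unfolding ends_def by (simp add: card_cartesian_product)
    qed
    moreover have "finite K" unfolding K_def using assms(1) by simp
    ultimately show ?thesis by blast
  next
    case False
    \<comment> \<open>The non-isolated vertex with demand 0, if there is one, has to be
      \<open>u\<close>; then all other non-isolated vertices, in particular \<open>c\<close>, have
      positive demand.\<close>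
    have "\<exists>c u. {c, u} \<in> E \<and> (\<forall>v\<in>W. n v = 0 \<longrightarrow> 0 < degree E v \<longrightarrow> v = u)"
    proof (cases "\<exists>w\<in>W. n w = 0 \<and> 0 < degree E w")
      case True
      then obtain w where w: "w \<in> W" "n w = 0" "0 < degree E w" by blast
      then have "{e \<in> E. w \<in> e} \<noteq> {}" unfolding degree_def by (metis card.empty less_irrefl)
      then obtain e where "e \<in> E" "w \<in> e" by blast
      moreover from this obtain c where "e = {c, w}"
        using less.prems(1)[of e] unfolding card_2_iff by auto
      ultimately show ?thesis using w less.prems(3)[OF _ w(1) _ w(2) _ w(3)] by blast
    next
      case none: False
      obtain e where "e \<in> E" using False by blast
      moreover from this obtain c u where "e = {c, u}"
        using less.prems(1)[of e] unfolding card_2_iff by auto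
      ultimately show ?thesis using none by blast
    qed
    then obtain c u where cu: "{c, u} \<in> E"
      and zero: "\<And>v. v \<in> W \<Longrightarrow> n v = 0 \<Longrightarrow> 0 < degree E v \<Longrightarrow> v = u" by blast
    have "c \<noteq> u" using less.prems(1)[OF cu] by auto
    have cuW: "c \<in> W" "u \<in> W" using less.prems(1)[OF cu] by auto
    have pos: "0 < n v" if "v \<in> W" "v \<noteq> u" "0 < degree E v" for v
      using zero that by (meson neq0_conv)
    have "0 < n c" using pos[of c] cuW \<open>c \<noteq> u\<close> degree_pos[OF finE cu, of c] by simp
    define E1 where "E1 = E - {{c, u}}"
    define n1 where "n1 = n(u := n u + 1, c := n c - 1)"
    note deg = degree_remove[OF finE cu, folded E1_def]
    have "\<exists>(K :: ('a \<times> nat) set) Q. finite K \<and> path_decomposition W E1 K Q \<and> (\<forall>v\<in>W. ends K Q v = n1 v)"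
    proof (rule less.hyps)
      show "card E1 < card E" unfolding E1_def using finE cu by (meson card_Diff1_less)
      show "e \<subseteq> W \<and> card e = 2" if "e \<in> E1" for e using that less.prems(1) E1_def by auto
      show "even (n1 v + degree E1 v)" if "v \<in> W" for v
        using less.prems(2)[OF that] deg[of v] \<open>0 < n c\<close> \<open>c \<noteq> u\<close>
        unfolding n1_def by (auto simp: even_diff_nat)
      show "v = w" if "v \<in> W" "w \<in> W" "n1 v = 0" "n1 w = 0" "0 < degree E1 v" "0 < degree E1 w" for v w
      proof -
        \<comment> \<open>Raising the demand at \<open>u\<close> removes the only possible zero at a
          non-isolated vertex, and lowering it at \<open>c\<close> creates at most one.\<close>
        have "v' = c" if "v' \<in> W" "n1 v' = 0" "0 < degree E1 v'" for v'
          using that pos[of v'] deg[of v'] unfolding n1_def by (auto split: if_splits)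
        then show ?thesis using that by metis
      qed
    qed
    then obtain K :: "('a \<times> nat) set" and Q where K: "finite K" and Q: "path_decomposition W E1 K Q"
      and ends: "\<And>v. v \<in> W \<Longrightarrow> ends K Q v = n1 v" by blast
    \<comment> \<open>Each neighbour of \<open>c\<close>, including \<open>u\<close>, has positive
      demand \<open>n1\<close> and is therefore an end of some path; \<open>d\<close> designates
      one.\<close>
    define F where "F = {v. {c, v} \<in> E}"
    have FW: "F \<subseteq> W" using less.prems(1) unfolding F_def by blast
    have "\<forall>v\<in>F. \<exists>j. j \<in> K \<times> UNIV \<and> hd (Q j) = v"
    proof
      fix v assume v: "v \<in> F"
      then have "{c, v} \<in> E" "v \<in> W" "v \<noteq> c" using FW less.prems(1) unfolding F_def by fastforce+
      then have "0 < n1 v"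
        using pos[of v] degree_pos[OF finE, of "{c, v}" v] unfolding n1_def by auto
      then have "{j \<in> K \<times> UNIV. hd (Q j) = v} \<noteq> {}"
        using ends[OF \<open>v \<in> W\<close>] unfolding ends_def by (metis card.empty less_irrefl)
      then show "\<exists>j. j \<in> K \<times> UNIV \<and> hd (Q j) = v" by blast
    qed
    then obtain d where d: "\<And>v. v \<in> F \<Longrightarrow> d v \<in> K \<times> UNIV \<and> hd (Q (d v)) = v" by metis
    have "\<exists>Q'. path_decomposition W E K Q' \<and>
      (\<forall>v. ends K Q' v + of_bool (u = v) = ends K Q v + of_bool (c = v))"
    proof (rule add_edge[OF K, of F])
      show "z \<in> F" if "v \<in> F" "Q (d v) = p @ z # c # r" for v p z r
      proof -
        have "{z, c} \<in> path_edges (Q (d v))"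
          using path_edges_append[of p z "c # r"] that by simp
        moreover have "path_edges (Q (d v)) \<subseteq> E1"
          using d[OF that(1)] path_decompositionD(5)[OF Q] by (cases "d v") auto
        ultimately show ?thesis unfolding F_def E1_def by (auto simp: insert_commute)
      qed
      show "c \<notin> F" using less.prems(1)[of "{c, c}"] unfolding F_def by auto
      show "finite F" using FW assms(1) finite_subset by blast
    qed (use Q cu cuW d in \<open>auto simp: E1_def F_def\<close>)
    then obtain Q' where Q': "path_decomposition W E K Q'"
      and ends': "\<And>v. ends K Q' v + of_bool (u = v) = ends K Q v + of_bool (c = v)" by blast
    have "ends K Q' v = n v" if "v \<in> W" for v
      using ends'[of v] ends[OF that] \<open>0 < n c\<close> \<open>c \<noteq> u\<close> unfolding n1_def
      by (auto split: if_splits)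
    with Q' K show ?thesis by blast
  qed
qed

lemma sum_ends:
  assumes "finite K" "finite N"
  shows "(\<Sum>v\<in>N. ends K Q v) = card {j \<in> K \<times> UNIV. hd (Q j) \<in> N}"
proof -
  let ?J = "{j \<in> K \<times> (UNIV :: bool set). hd (Q j) \<in> N}"
  have "(\<Sum>v\<in>N. \<Sum>j\<in>{j. j \<in> ?J \<and> hd (Q j) = v}. 1) = (\<Sum>j\<in>?J. 1::nat)"
    using assms by (intro sum.group) auto
  moreover have "{j. j \<in> ?J \<and> hd (Q j) = v} = {j \<in> K \<times> UNIV. hd (Q j) = v}" if "v \<in> N" for v
    using that by auto
  ultimately show ?thesis unfolding ends_def by simp
qed

lemma sum_ends_all:
  assumes "path_decomposition W E K Q" "finite K" "finite W"
  shows "(\<Sum>v\<in>W. ends K Q v) = 2 * card K"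
proof -
  have "hd (Q j) \<in> W" if "j \<in> K \<times> UNIV" for j
    using that path_decompositionD(2,4)[OF assms(1)] hd_in_set by (cases j) blast
  then have "{j \<in> K \<times> (UNIV :: bool set). hd (Q j) \<in> W} = K \<times> UNIV" by auto
  then show ?thesis using sum_ends[OF assms(2,3), of Q] by (simp add: card_cartesian_product)
qed

section \<open>Graphs with a universal vertex\<close>

text \<open>Each path is closed through \<open>y\<close>. For a one-vertex path both connecting
  edges coincide, so the same formula for \<open>C\<close> then yields a single edge.\<close>

lemma coverable_apex:
  assumes "finite K"
    and P: "\<And>i. i \<in> K \<Longrightarrow> P i \<noteq> [] \<and> distinct (P i) \<and> y \<notin> set (P i) \<and> path_edges (P i) \<subseteq> E \<and>
      {y, hd (P i)} \<in> E \<and> {y, last (P i)} \<in> E"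
    and E: "\<And>e. e \<in> E \<Longrightarrow> card e = 2"
    and off: "\<And>e. e \<in> E \<Longrightarrow> y \<notin> e \<Longrightarrow> \<exists>i\<in>K. e \<in> path_edges (P i)"
    and at: "\<And>v. {y, v} \<in> E \<Longrightarrow> \<exists>i\<in>K. v = hd (P i) \<or> v = last (P i)"
  shows "coverable E (card K)"
proof -
  define C where "C i = {{y, hd (P i)}, {y, last (P i)}} \<union> path_edges (P i)" for i
  have C: "cycle_or_edge (C i) \<and> C i \<subseteq> E" if i: "i \<in> K" for i
  proof (cases "2 \<le> length (P i)")
    case True
    have "C i = cycle_edges (y # P i)" using P[OF i] unfolding C_def by (simp add: cycle_edges_closed)
    moreover have "cycle_or_edge (cycle_edges (y # P i))"
      using P[OF i] True by (intro cycle_or_edge_cycle) auto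
    moreover have "C i \<subseteq> E" using P[OF i] unfolding C_def by auto
    ultimately show ?thesis by simp
  next
    case False
    then obtain v where "P i = [v]" using P[OF i] by (cases "P i" rule: remdups_adj.cases) auto
    moreover from this have "y \<noteq> v" using P[OF i] by auto
    ultimately show ?thesis using P[OF i] cycle_or_edge_single[of y v] unfolding C_def by auto
  qed
  have "E \<subseteq> \<Union>(C ` K)"
  proof
    fix e assume e: "e \<in> E"
    show "e \<in> \<Union>(C ` K)"
    proof (cases "y \<in> e")
      case True
      then obtain v where "e = {y, v}" using E[OF e] unfolding card_2_iff by auto
      then show ?thesis using at[of v] e unfolding C_def by auto
    next
      case False
      then show ?thesis using off[OF e] unfolding C_def by auto
    qed
  qed
  then have union: "\<Union>(C ` K) = E" using C by blast
  obtain ks where ks: "set ks = K" "distinct ks" using finite_distinct_list[OF assms(1)] by blast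
  have "ce_cover E (map C ks)" unfolding ce_cover_iff using C union ks(1) by simp
  moreover have "length (map C ks) = card K" using ks distinct_card[of ks] by simp
  ultimately show ?thesis unfolding coverable_def by (intro exI[of _ "map C ks"]) simp
qed

text \<open>Every edge \<open>v\<^sub>0z\<close> is the one before \<open>v\<^sub>0\<close> for just one path end, whereas two path ends lie at
  each neighbour of \<open>v\<^sub>0\<close>.\<close>

lemma path_avoiding_vertex:
  assumes Q: "path_decomposition W H K Q" and fin: "finite K" "finite N"
    and N: "N = {v. {v\<^sub>0, v} \<in> H}" "N \<noteq> {}" "v\<^sub>0 \<notin> N"
    and two: "\<And>v. v \<in> N \<Longrightarrow> ends K Q v = 2"
  shows "\<exists>j\<in>K \<times> UNIV. hd (Q j) \<in> N \<and> v\<^sub>0 \<notin> set (Q j)"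
proof (rule ccontr)
  assume none: "\<not> ?thesis"
  define J where "J = {j \<in> K \<times> UNIV. hd (Q j) \<in> N}"
  have "\<exists>z p r. Q j = p @ z # v\<^sub>0 # r" if j: "j \<in> J" for j
  proof -
    have "v\<^sub>0 \<in> set (Q j)" using none j unfolding J_def by blast
    then obtain p' r where pr: "Q j = p' @ v\<^sub>0 # r" by (meson split_list)
    then have "p' \<noteq> []" using j N(3) unfolding J_def by auto
    then show ?thesis using pr by (metis append.assoc append_Cons append_Nil append_butlast_last_id)
  qed
  \<comment> \<open>\<open>pre j\<close> is the vertex just before \<open>v\<^sub>0\<close> when the
    path is traversed from \<open>hd (Q j)\<close>.\<close>
  then obtain pre where pre: "\<And>j. j \<in> J \<Longrightarrow> \<exists>p r. Q j = p @ pre j # v\<^sub>0 # r" by metis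
  have edge: "{pre j, v\<^sub>0} \<in> path_edges (Q j)" if j: "j \<in> J" for j
  proof -
    obtain p r where "Q j = p @ pre j # v\<^sub>0 # r" using pre[OF j] by blast
    then show ?thesis using path_edges_append[of p "pre j" "v\<^sub>0 # r"] by simp
  qed
  have JK: "fst j \<in> K" if "j \<in> J" for j using that unfolding J_def by auto
  have edge_H: "{pre j, v\<^sub>0} \<in> H" if "j \<in> J" for j
    using edge[OF that] path_decompositionD(5)[OF Q JK[OF that], of "snd j"] by auto
  have "inj_on pre J"
  proof (rule inj_onI)
    fix j j' assume j: "j \<in> J" "j' \<in> J" "pre j = pre j'"
    have in_path: "{pre k, v\<^sub>0} \<in> path_edges (Q (fst k, True))" if "k \<in> J" for k
      using edge[OF that] path_edges_orientation[OF Q JK[OF that], of "snd k"] by simp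
    have fst_eq: "fst j = fst j'"
      using path_decomposition_ex1[OF Q edge_H[OF j(1)]] in_path[OF j(1)] in_path[OF j(2)] JK j by metis
    show "j = j'"
    proof (rule ccontr)
      \<comment> \<open>These would be the two orientations of one path, with \<open>pre j\<close>
        on both sides of \<open>v\<^sub>0\<close>.\<close>
      assume "j \<noteq> j'"
      then have j': "j' = (fst j, \<not> snd j)" using fst_eq by (cases j; cases j') auto
      obtain p r where p: "Q j = p @ pre j # v\<^sub>0 # r" using pre[OF j(1)] by blast
      obtain p' r' where p': "Q j' = p' @ pre j # v\<^sub>0 # r'" using pre[OF j(2)] j(3) by auto
      have rev: "Q j' = rev (Q j)"
        using path_decompositionD(1)[OF Q JK[OF j(1)], of "snd j"] j' by simp
      have dist: "distinct (Q j)" using path_decompositionD(3)[OF Q JK[OF j(1)], of "snd j"] by simp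
      have "rev r @ v\<^sub>0 # (pre j # rev p) = (p' @ [pre j]) @ v\<^sub>0 # r'"
        using rev p p' by simp
      moreover have "v\<^sub>0 \<notin> set (rev r)" "v\<^sub>0 \<notin> set (pre j # rev p)" using dist p by auto
      ultimately have "rev r = p' @ [pre j]" using append_Cons_eq_iff by metis
      then have "pre j \<in> set r" by (metis in_set_conv_decomp set_rev)
      then show False using dist p by auto
    qed
  qed
  moreover have "pre ` J \<subseteq> N" using edge_H N(1) by (auto simp: insert_commute)
  ultimately have "card J \<le> card N" using card_inj_on_le fin(2) by blast
  moreover have "card J = (\<Sum>v\<in>N. ends K Q v)" unfolding J_def using sum_ends[OF fin] by metis
  then have "card J = 2 * card N" using two by simp
  moreover have "0 < card N" using N(2) fin(2) by (simp add: card_gt_0_iff)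
  ultimately show False by linarith
qed

text \<open>The number of paths is half the sum of the prescribed ends over the
  \<open>card V - 1\<close> vertices other than \<open>y\<close>. A vertex of odd degree saves one
  end, and by integrality a path; if all degrees are even, dropping both ends at \<open>v0\<close>
  saves a path.\<close>

lemma coverable_universal:
  assumes "finite V" "y \<in> V" and E: "\<And>e. e \<in> E \<Longrightarrow> e \<subseteq> V \<and> card e = 2"
    and univ: "\<And>v. v \<in> V \<Longrightarrow> v \<noteq> y \<Longrightarrow> {y, v} \<in> E"
    and e0: "e0 \<in> E" "y \<notin> e0"
  shows "coverable E (card V - 2)"
proof -
  define W where "W = V - {y}"
  define H where "H = {e \<in> E. y \<notin> e}"
  have W: "finite W" "card W = card V - 1" unfolding W_def using assms by auto
  have H: "e \<subseteq> W \<and> card e = 2" if "e \<in> H" for e using that E unfolding H_def W_def by blast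
  have finH: "finite H" using H W(1) by (meson finite_Pow_iff finite_subset PowI subsetI)
  have loop: "{v, v} \<notin> E" for v using E[of "{v, v}"] by auto
  have inW: "v \<in> W" if "{y, v} \<in> E" for v using E[OF that] loop that unfolding W_def by auto
  have end_at: "\<exists>j\<in>K \<times> UNIV. hd (Q j) = v" if "0 < ends K Q v" for K :: "('a \<times> nat) set" and Q v
  proof -
    have "{j \<in> K \<times> UNIV. hd (Q j) = v} \<noteq> {}" using that unfolding ends_def by (metis card.empty less_irrefl)
    then show ?thesis by blast
  qed
  have path_ok: "R \<noteq> [] \<and> distinct R \<and> y \<notin> set R \<and> path_edges R \<subseteq> E \<and> {y, hd R} \<in> E \<and> {y, last R} \<in> E"
    if R: "R \<noteq> []" "distinct R" "set R \<subseteq> W" "path_edges R \<subseteq> H" for R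
  proof -
    have "hd R \<in> W" "last R \<in> W" using R by auto
    then have "{y, hd R} \<in> E" "{y, last R} \<in> E" using univ unfolding W_def by auto
    moreover have "y \<notin> set R" using R unfolding W_def by auto
    ultimately show ?thesis using R unfolding H_def by auto
  qed
  show ?thesis
  proof (cases "\<exists>v\<in>W. odd (degree H v)")
    case True
    then obtain v1 where v1: "v1 \<in> W" "odd (degree H v1)" by blast
    define n where "n v = (if odd (degree H v) then 1 else 2 :: nat)" for v
    have n_pos: "0 < n v" for v unfolding n_def by simp
    have "\<exists>(K :: ('a \<times> nat) set) Q. finite K \<and> path_decomposition W H K Q \<and> (\<forall>v\<in>W. ends K Q v = n v)"
    proof (rule path_decomposition_exists)
      show "even (n v + degree H v)" for v unfolding n_def by simp
      show "u = v" if "n u = 0" for u v using that n_pos[of u] by simp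
    qed (use W(1) H in auto)
    then obtain K :: "('a \<times> nat) set" and Q where K: "finite K" and Q: "path_decomposition W H K Q"
      and ends: "\<And>v. v \<in> W \<Longrightarrow> ends K Q v = n v" by blast
    have "2 * card K = (\<Sum>v\<in>W. n v)" using sum_ends_all[OF Q K W(1)] ends by simp
    also have "\<dots> = n v1 + (\<Sum>v\<in>W - {v1}. n v)" using W(1) v1(1) by (simp add: sum.remove)
    also have "\<dots> \<le> 1 + (\<Sum>v\<in>W - {v1}. 2)" using v1 unfolding n_def by (intro add_mono sum_mono) auto
    also have "\<dots> = 1 + 2 * (card W - 1)" using W(1) v1(1) by simp
    finally have "card K \<le> card W - 1" by linarith
    moreover have "coverable E (card K)"
    proof (rule coverable_apex[OF K, of "\<lambda>i. Q (i, True)" y])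
      show "\<exists>i\<in>K. e \<in> path_edges (Q (i, True))" if "e \<in> E" "y \<notin> e" for e
        using path_decomposition_ex1[OF Q, of e] that unfolding H_def by blast
      show "\<exists>i\<in>K. v = hd (Q (i, True)) \<or> v = last (Q (i, True))" if yv: "{y, v} \<in> E" for v
      proof -
        obtain i b where ib: "i \<in> K" "hd (Q (i, b)) = v"
          using end_at[of K Q v] ends[OF inW[OF yv]] n_pos by auto
        then show ?thesis
          using path_decompositionD(1,2)[OF Q ib(1), of True] by (cases b) (auto simp: hd_rev)
      qed
    qed (use E path_ok path_decompositionD[OF Q] in auto)
    ultimately show ?thesis unfolding coverable_def W(2) by fastforce
  next
    case False
    obtain v0 s0 where e0': "e0 = {v0, s0}" using E[OF e0(1)] unfolding card_2_iff by auto
    then have v0: "{v0, s0} \<in> H" "v0 \<in> W" using e0 H[of e0] unfolding H_def by auto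
    define n where "n v = (if v = v0 then 0 else 2 :: nat)" for v
    have "\<exists>(K :: ('a \<times> nat) set) Q. finite K \<and> path_decomposition W H K Q \<and> (\<forall>v\<in>W. ends K Q v = n v)"
    proof (rule path_decomposition_exists)
      show "even (n v + degree H v)" if "v \<in> W" for v using False that unfolding n_def by simp
      show "u = v" if "n u = 0" "n v = 0" for u v using that unfolding n_def by (simp split: if_splits)
    qed (use W(1) H in auto)
    then obtain K :: "('a \<times> nat) set" and Q where K: "finite K" and Q: "path_decomposition W H K Q"
      and ends: "\<And>v. v \<in> W \<Longrightarrow> ends K Q v = n v" by blast
    have "2 * card K = (\<Sum>v\<in>W. n v)" using sum_ends_all[OF Q K W(1)] ends by simp
    also have "\<dots> = n v0 + (\<Sum>v\<in>W - {v0}. n v)" using W(1) v0(2) by (simp add: sum.remove)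
    also have "\<dots> = (\<Sum>v\<in>W - {v0}. 2)" unfolding n_def by (simp cong: sum.cong_simp)
    also have "\<dots> = 2 * (card W - 1)" using W(1) v0(2) by simp
    finally have card_K: "card K = card V - 2" using W(2) by linarith
    define N where "N = {v. {v0, v} \<in> H}"
    have NW: "N \<subseteq> W" using H unfolding N_def by blast
    have "v0 \<notin> N" using loop unfolding N_def H_def by auto
    have two: "ends K Q v = 2" if "v \<in> W" "v \<noteq> v0" for v
      using ends[OF that(1)] that(2) unfolding n_def by simp
    have "\<exists>j\<in>K \<times> UNIV. hd (Q j) \<in> N \<and> v0 \<notin> set (Q j)"
    proof (rule path_avoiding_vertex[OF Q K _ N_def])
      show "finite N" using NW W(1) finite_subset by blast
      show "N \<noteq> {}" using v0(1) unfolding N_def by blast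
      show "ends K Q v = 2" if "v \<in> N" for v using two that NW \<open>v0 \<notin> N\<close> by blast
    qed (rule \<open>v0 \<notin> N\<close>)
    then obtain i b where ib: "i \<in> K" "hd (Q (i, b)) \<in> N" "v0 \<notin> set (Q (i, b))" by auto
    note Qi = path_decompositionD[OF Q ib(1)]
    \<comment> \<open>Prolonging one path makes \<open>v0\<close> an end. The new edge also lies in
      another path, which is harmless for a cover.\<close>
    define P where "P k = (if k = i then v0 # Q (i, b) else Q (k, True))" for k
    have "coverable E (card K)"
    proof (rule coverable_apex[OF K, of P y])
      fix k assume k: "k \<in> K"
      show "P k \<noteq> [] \<and> distinct (P k) \<and> y \<notin> set (P k) \<and> path_edges (P k) \<subseteq> E \<and>
        {y, hd (P k)} \<in> E \<and> {y, last (P k)} \<in> E"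
      proof (rule path_ok)
        show "P k \<noteq> []" "distinct (P k)" "set (P k) \<subseteq> W"
          using path_decompositionD(2-4)[OF Q k, of True] Qi(2-4)[of b] ib(3) v0(2) unfolding P_def by auto
        show "path_edges (P k) \<subseteq> H"
          using path_decompositionD(5)[OF Q k, of True] Qi(2,5)[of b] ib(2) unfolding P_def N_def
          by (auto simp: path_edges_Cons)
      qed
    next
      show "\<exists>k\<in>K. e \<in> path_edges (P k)" if e: "e \<in> E" "y \<notin> e" for e
      proof -
        obtain k where k: "k \<in> K" "e \<in> path_edges (Q (k, True))"
          using path_decomposition_ex1[OF Q, of e] e unfolding H_def by blast
        then have "e \<in> path_edges (P k)"
          using path_edges_orientation[OF Q k(1), of b] Qi[of b] unfolding P_def
          by (auto simp: path_edges_Cons)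
        with k show ?thesis by blast
      qed
      show "\<exists>k\<in>K. v = hd (P k) \<or> v = last (P k)" if yv: "{y, v} \<in> E" for v
      proof (cases "v = v0")
        case True
        then show ?thesis using ib(1) unfolding P_def by auto
      next
        case False
        then have "card {j \<in> K \<times> UNIV. hd (Q j) = v} = 2"
          using two[OF inW[OF yv]] unfolding ends_def by simp
        \<comment> \<open>Prolonging destroys only the end at \<open>(i, b)\<close>, so at least one
          of the two ends at \<open>v\<close> survives.\<close>
        then have "\<not> {j \<in> K \<times> UNIV. hd (Q j) = v} \<subseteq> {(i, b)}"
          using card_mono[of "{(i, b)}" "{j \<in> K \<times> UNIV. hd (Q j) = v}"] by auto
        then obtain k c where k: "k \<in> K" "hd (Q (k, c)) = v" "(k, c) \<noteq> (i, b)" by auto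
        have "v = hd (P k) \<or> v = last (P k)"
        proof (cases "k = i")
          case True
          then have "c = (\<not> b)" using k(3) by auto
          then show ?thesis using True k(2) Qi[of b] unfolding P_def by (simp add: hd_rev)
        next
          case False
          then show ?thesis
            using path_decompositionD(1,2)[OF Q k(1), of True] k(2) unfolding P_def
            by (cases c) (auto simp: hd_rev)
        qed
        with k(1) show ?thesis by blast
      qed
    qed (use E in auto)
    then show ?thesis unfolding card_K .
  qed
qed

section \<open>Reduction to a universal vertex\<close>

lemma simple_graphD:
  assumes "simple_graph V E"
  shows "finite V" "V \<noteq> {}" "\<And>e. e \<in> E \<Longrightarrow> e \<subseteq> V \<and> card e = 2" "finite E"
proof -
  show V: "finite V" "V \<noteq> {}" and E: "\<And>e. e \<in> E \<Longrightarrow> e \<subseteq> V \<and> card e = 2"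
    using assms unfolding simple_graph_def by auto
  then have "E \<subseteq> Pow V" by auto
  then show "finite E" using V(1) finite_subset by auto
qed

lemma kelmans_shift_properties:
  assumes G: "simple_graph V E" and xy: "{x, y} \<in> E"
  shows "simple_graph V (kelmans_shift x y E)" "card (kelmans_shift x y E) = card E"
    and "\<And>v. {y, v} \<in> E \<Longrightarrow> {y, v} \<in> kelmans_shift x y E"
    and "\<And>v. {x, v} \<in> E \<Longrightarrow> v \<noteq> y \<Longrightarrow> {y, v} \<in> kelmans_shift x y E"
    and "connected_graph V E \<Longrightarrow> connected_graph V (kelmans_shift x y E)"
proof -
  define B where "B = {b. {x, b} \<in> E \<and> {y, b} \<notin> E \<and> b \<noteq> y}"
  define E' where "E' = (E - (\<lambda>b. {x, b}) ` B) \<union> (\<lambda>b. {y, b}) ` B"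
  have E'_eq: "kelmans_shift x y E = E'"
    unfolding kelmans_shift_def E'_def B_def Let_def ..
  note G' = simple_graphD[OF G]
  have "x \<noteq> y" "x \<in> V" "y \<in> V" using G'(3)[OF xy] by auto
  have loop: "{v, v} \<notin> E" for v using G'(3)[of "{v, v}"] by auto
  have B: "y \<notin> B" "x \<notin> B" "B \<subseteq> V" unfolding B_def using loop G'(3) by fastforce+
  have "{y, b} \<subseteq> V \<and> card {y, b} = 2" if "b \<in> B" for b
    using that B \<open>y \<in> V\<close> by (metis card_2_iff empty_subsetI insert_subset subsetD)
  then show "simple_graph V (kelmans_shift x y E)"
    unfolding E'_eq simple_graph_def E'_def using G' by auto
  have inj: "inj_on (\<lambda>b. {v, b}) B" for v by (auto simp: inj_on_def doubleton_eq_iff)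
  have sub: "(\<lambda>b. {x, b}) ` B \<subseteq> E" and disj: "E \<inter> (\<lambda>b. {y, b}) ` B = {}" unfolding B_def by auto
  have finB: "finite B" using B G'(1) finite_subset by auto
  have "card E' = card (E - (\<lambda>b. {x, b}) ` B) + card ((\<lambda>b. {y, b}) ` B)"
    unfolding E'_def using G'(4) finB disj by (intro card_Un_disjoint) auto
  also have "\<dots> = card E"
    using sub finB G'(4) card_mono[OF G'(4) sub] by (simp add: card_Diff_subset card_image[OF inj])
  finally show "card (kelmans_shift x y E) = card E" unfolding E'_eq .
  have img: "{y, s} \<notin> (\<lambda>b. {x, b}) ` B" for s
    using B(1) \<open>x \<noteq> y\<close> by (auto simp: doubleton_eq_iff)
  show keep: "{y, v} \<in> kelmans_shift x y E" if "{y, v} \<in> E" for v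
    unfolding E'_eq E'_def using that img by blast
  show moved: "{y, v} \<in> kelmans_shift x y E" if "{x, v} \<in> E" "v \<noteq> y" for v
    using keep[of v] that unfolding E'_eq E'_def B_def by blast
  show "connected_graph V (kelmans_shift x y E)" if conn: "connected_graph V E"
  proof -
    let ?R' = "{(u, v). {u, v} \<in> E'}"
    have step: "(u, v) \<in> ?R'\<^sup>*" if uv: "{u, v} \<in> E" for u v
    proof (cases "{u, v} \<in> E'")
      case True
      then show ?thesis by blast
    next
      case False
      \<comment> \<open>A lost edge \<open>xb\<close> is replaced by the walk from \<open>x\<close>
        over \<open>y\<close> to \<open>b\<close>.\<close>
      then obtain b where b: "b \<in> B" "{u, v} = {x, b}" using uv unfolding E'_def by auto
      have "{x, y} \<in> E'" using keep[of x] xy unfolding E'_eq by (simp add: insert_commute)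
      moreover have "{y, b} \<in> E'" using b unfolding E'_def by auto
      ultimately have "(x, y) \<in> ?R'" "(y, b) \<in> ?R'" "(b, y) \<in> ?R'" "(y, x) \<in> ?R'"
        by (auto simp: insert_commute)
      then have "(x, b) \<in> ?R'\<^sup>*" "(b, x) \<in> ?R'\<^sup>*" by (meson converse_rtrancl_into_rtrancl r_into_rtrancl)+
      then show ?thesis using b(2) by (auto simp: doubleton_eq_iff)
    qed
    have "{(u, v). {u, v} \<in> E}\<^sup>* \<subseteq> ?R'\<^sup>*"
      using step by (intro rtrancl_subset_rtrancl) auto
    then show ?thesis using conn unfolding connected_graph_def E'_eq by blast
  qed
qed

text \<open>Induction on the number of vertices not adjacent to \<open>y\<close>: a shift along
  \<open>xy\<close> keeps the neighbours of \<open>y\<close> and adds those of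
  \<open>x\<close>.\<close>

lemma universal_vertex_reduction:
  assumes "simple_graph V E" "connected_graph V E" "y \<in> V"
  obtains E' where "simple_graph V E'" "card E' = card E" "\<And>v. v \<in> V \<Longrightarrow> v \<noteq> y \<Longrightarrow> {y, v} \<in> E'"
    "\<And>k. coverable E' k \<Longrightarrow> coverable E k"
proof -
  have "\<exists>E'. simple_graph V E' \<and> card E' = card E \<and> (\<forall>v\<in>V - {y}. {y, v} \<in> E') \<and>
      (\<forall>k. coverable E' k \<longrightarrow> coverable E k)"
    using assms(1,2)
  proof (induction "card {v \<in> V - {y}. {y, v} \<notin> E}" arbitrary: E rule: less_induct)
    case less
    note G = simple_graphD[OF less.prems(1)]
    show ?case
    proof (cases "\<forall>v\<in>V - {y}. {y, v} \<in> E")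
      case True
      then show ?thesis using less.prems(1) by blast
    next
      case False
      then obtain v where v: "v \<in> V" "v \<noteq> y" "{y, v} \<notin> E" by blast
      have "\<exists>x b. {x, y} \<in> E \<and> {x, b} \<in> E \<and> b \<noteq> y \<and> {y, b} \<notin> E"
      proof (rule ccontr)
        \<comment> \<open>Then \<open>y\<close> and its neighbours would be closed under adjacency
          and, by connectedness, exhaust \<open>V\<close>.\<close>
        assume none: "\<not> ?thesis"
        have "(y, v) \<in> {(u, w). {u, w} \<in> E}\<^sup>*"
          using less.prems(2) assms(3) v(1) unfolding connected_graph_def by blast
        then have "v = y \<or> {y, v} \<in> E"
        proof (induction rule: rtrancl_induct)
          case (step u w)
          then show ?case using none by (auto simp: insert_commute)
        qed simp
        then show False using v by blast
      qed
      then obtain x b where xb: "{x, y} \<in> E" "{x, b} \<in> E" "b \<noteq> y" "{y, b} \<notin> E" by blast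
      note K = kelmans_shift_properties[OF less.prems(1) xb(1)]
      have "b \<in> V" using G(3)[OF xb(2)] by auto
      have "\<exists>E'. simple_graph V E' \<and> card E' = card (kelmans_shift x y E) \<and>
        (\<forall>v\<in>V - {y}. {y, v} \<in> E') \<and> (\<forall>k. coverable E' k \<longrightarrow> coverable (kelmans_shift x y E) k)"
      proof (rule less.hyps)
        have "{v \<in> V - {y}. {y, v} \<notin> kelmans_shift x y E} \<subset> {v \<in> V - {y}. {y, v} \<notin> E}"
          using K(3) K(4)[OF xb(2,3)] xb(3,4) \<open>b \<in> V\<close> by blast
        then show "card {v \<in> V - {y}. {y, v} \<notin> kelmans_shift x y E} < card {v \<in> V - {y}. {y, v} \<notin> E}"
          using G(1) by (intro psubset_card_mono) auto
      qed (use K less.prems in auto)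
      moreover have "coverable (kelmans_shift x y E) k \<Longrightarrow> coverable E k" for k
        using coverable_kelmans_shift[of E x y k] G(3) xb(1) by blast
      ultimately show ?thesis using K(2) by metis
    qed
  qed
  then show ?thesis using that by blast
qed

section \<open>Covers of connected and of arbitrary graphs\<close>

lemma coverable_mono: "coverable E k \<Longrightarrow> k \<le> l \<Longrightarrow> coverable E l"
  unfolding coverable_def by fastforce

lemma coverable_Un: "coverable E k \<Longrightarrow> coverable F l \<Longrightarrow> coverable (E \<union> F) (k + l)"
proof -
  assume "coverable E k" "coverable F l"
  then obtain Es Fs where "ce_cover E Es" "length Es \<le> k" "ce_cover F Fs" "length Fs \<le> l"
    unfolding coverable_def by blast
  then have "ce_cover (E \<union> F) (Es @ Fs)" "length (Es @ Fs) \<le> k + l"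
    unfolding ce_cover_iff by auto
  then show "coverable (E \<union> F) (k + l)" unfolding coverable_def by blast
qed

lemma coverable_single_edges:
  assumes "finite E" "\<And>e. e \<in> E \<Longrightarrow> card e = 2"
  shows "coverable E (card E)"
  using assms
proof (induction E)
  case empty
  have "ce_cover {} []" unfolding ce_cover_iff by simp
  then show ?case unfolding coverable_def by force
next
  case (insert e E)
  obtain u v where "e = {u, v}" "u \<noteq> v" using insert.prems[of e] unfolding card_2_iff by auto
  then have "ce_cover {e} [{e}]" unfolding ce_cover_iff using cycle_or_edge_single by auto
  then have "coverable {e} 1" unfolding coverable_def by force
  from coverable_Un[OF this insert.IH] insert show ?case by simp
qed

text \<open>The second alternative arises when the shifted graph is a star. It is stated as an edge
  count because shifts preserve that number.\<close>

lemma connected_coverable: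
  assumes G: "simple_graph V E" "connected_graph V E"
  shows "coverable E (card V - 2) \<and> 2 \<le> card V \<or> card E = card V - 1"
proof -
  obtain y where y: "y \<in> V" using simple_graphD(2)[OF G(1)] by blast
  obtain E' where E': "simple_graph V E'" "card E' = card E"
    "\<And>v. v \<in> V \<Longrightarrow> v \<noteq> y \<Longrightarrow> {y, v} \<in> E'" "\<And>k. coverable E' k \<Longrightarrow> coverable E k"
    using universal_vertex_reduction[OF G y] by metis
  note G' = simple_graphD[OF E'(1)]
  show ?thesis
  proof (cases "\<exists>e\<in>E'. y \<notin> e")
    case True
    then obtain e where e: "e \<in> E'" "y \<notin> e" by blast
    have "coverable E' (card V - 2)"
      using coverable_universal[OF G'(1) y G'(3) E'(3) e] by simp
    moreover have "2 \<le> card V" using G'(3)[OF e(1)] G'(1) card_mono by metis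
    ultimately show ?thesis using E'(4) by blast
  next
    case False
    have "E' = (\<lambda>v. {y, v}) ` (V - {y})"
    proof
      show "E' \<subseteq> (\<lambda>v. {y, v}) ` (V - {y})"
      proof
        fix e assume e: "e \<in> E'"
        then have "card e = 2" "y \<in> e" "e \<subseteq> V" using False G'(3) by blast+
        then obtain v where "e = {y, v}" "v \<noteq> y" "v \<in> V" unfolding card_2_iff by auto
        then show "e \<in> (\<lambda>v. {y, v}) ` (V - {y})" by blast
      qed
    qed (use E'(3) in auto)
    moreover have "inj_on (\<lambda>v. {y, v}) (V - {y})" by (auto simp: inj_on_def doubleton_eq_iff)
    ultimately have "card E' = card V - 1" using y G'(1) by (simp add: card_image)
    then show ?thesis using E'(2) by simp
  qed
qed

text \<open>The parts are the component of one vertex and all the rest, which may itself be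
  disconnected.\<close>

lemma disconnected_split:
  assumes G: "simple_graph V E" "\<not> connected_graph V E"
  obtains V1 V2 E1 E2 where "V = V1 \<union> V2" "V1 \<inter> V2 = {}" "E = E1 \<union> E2"
    "simple_graph V1 E1" "simple_graph V2 E2"
proof -
  let ?R = "{(u, v). {u, v} \<in> E}"
  obtain u v where uv: "u \<in> V" "v \<in> V" "(u, v) \<notin> ?R\<^sup>*"
    using G(2) unfolding connected_graph_def by blast
  define V1 where "V1 = {w \<in> V. (u, w) \<in> ?R\<^sup>*}"
  note G' = simple_graphD[OF G(1)]
  have closed: "w \<in> V1" if e: "{w', w} \<in> E" "w' \<in> V1" for w w'
    using e G'(3)[OF e(1)] rtrancl_into_rtrancl[of u w' ?R w] unfolding V1_def by auto
  have split: "e \<subseteq> V1 \<or> e \<subseteq> V - V1" if e: "e \<in> E" for e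
  proof -
    obtain a b where ab: "e = {a, b}" using G'(3)[OF e] unfolding card_2_iff by auto
    have "a \<in> V1 \<longleftrightarrow> b \<in> V1" using closed[of a b] closed[of b a] e ab by (auto simp: insert_commute)
    then show ?thesis using ab G'(3)[OF e] by auto
  qed
  have "u \<in> V1" "v \<in> V - V1" using uv unfolding V1_def by auto
  moreover have "V1 \<subseteq> V" unfolding V1_def by auto
  moreover from this have "finite V1" using G'(1) finite_subset by blast
  ultimately have "simple_graph V1 {e \<in> E. e \<subseteq> V1}" "simple_graph (V - V1) {e \<in> E. e \<subseteq> V - V1}"
    using G' unfolding simple_graph_def by auto
  moreover have "E = {e \<in> E. e \<subseteq> V1} \<union> {e \<in> E. e \<subseteq> V - V1}" using split by auto
  moreover have "V = V1 \<union> (V - V1)" using \<open>V1 \<subseteq> V\<close> by auto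
  ultimately show ?thesis using that[of V1 "V - V1"] by blast
qed

lemma split_card:
  assumes "V = V1 \<union> V2" "V1 \<inter> V2 = {}" "simple_graph V1 E1" "simple_graph V2 E2"
  shows "card V = card V1 + card V2" "0 < card V1" "0 < card V2"
  using assms simple_graphD(1,2)[OF assms(3)] simple_graphD(1,2)[OF assms(4)]
  by (auto simp: card_Un_disjoint card_gt_0_iff)

text \<open>This weaker bound includes trees, as is necessary for applying it to both parts of a
  disconnected graph.\<close>

lemma coverable_pred_card:
  assumes "simple_graph V E"
  shows "coverable E (card V - 1)"
  using assms
proof (induction "card V" arbitrary: V E rule: less_induct)
  case less
  show ?case
  proof (cases "connected_graph V E")
    case True
    from connected_coverable[OF less.prems True] show ?thesis
    proof
      assume "coverable E (card V - 2) \<and> 2 \<le> card V"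
      then show ?thesis using coverable_mono[of E "card V - 2" "card V - 1"] by simp
    next
      assume "card E = card V - 1"
      then show ?thesis
        using coverable_single_edges[of E] simple_graphD(3,4)[OF less.prems] by simp
    qed
  next
    case False
    obtain V1 V2 E1 E2 where s: "V = V1 \<union> V2" "V1 \<inter> V2 = {}" "E = E1 \<union> E2"
      "simple_graph V1 E1" "simple_graph V2 E2" using disconnected_split[OF less.prems False] .
    note c = split_card[OF s(1,2,4,5)]
    have "coverable E1 (card V1 - 1)" "coverable E2 (card V2 - 1)"
      using less.hyps[OF _ s(4)] less.hyps[OF _ s(5)] c by auto
    then have "coverable E (card V1 - 1 + (card V2 - 1))"
      unfolding s(3) by (rule coverable_Un)
    then show ?thesis using c by (auto intro: coverable_mono)
  qed
qed

section \<open>The bound for graphs that are not trees\<close>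

lemma card_cycle_edges_ge_2:
  assumes "distinct vs" "3 \<le> length vs" "finite (cycle_edges vs)"
  shows "2 \<le> card (cycle_edges vs)"
proof -
  obtain a b c ws where vs: "vs = a # b # c # ws"
    using assms(2) by (metis Suc_le_length_iff numeral_3_eq_3)
  then have "{{a, b}, {b, c}} \<subseteq> cycle_edges vs" unfolding cycle_edges_def by auto
  then have "card {{a, b}, {b, c}} \<le> card (cycle_edges vs)" using assms(3) by (rule card_mono[rotated])
  moreover have "{a, b} \<noteq> {b, c}" using assms(1) vs by (auto simp: doubleton_eq_iff)
  ultimately show ?thesis by simp
qed

text \<open>Either there is a cycle in a connected graph, or two separate parts save one member
  each. The conjunct \<open>2 \<le> card V\<close> makes the subtraction exact, as the final
  statement over the integers requires.\<close>

lemma coverable_if_not_tree: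
  assumes G: "simple_graph V E" and not_tree: "\<not> is_tree V E"
  shows "coverable E (card V - 2) \<and> 2 \<le> card V"
proof (cases "connected_graph V E")
  case True
  then have "\<not> acyclic_graph V E" using assms unfolding is_tree_def by blast
  then obtain W F where F: "F \<subseteq> E" "is_cycle W F" unfolding acyclic_graph_def by blast
  then obtain vs where vs: "distinct vs" "3 \<le> length vs" "W = set vs"
    "F = {{vs ! i, vs ! (Suc i mod length vs)} | i. i < length vs}" unfolding is_cycle_def by blast
  then have "vs \<noteq> []" by auto
  have Fc: "F = cycle_edges vs" unfolding cycle_edges_nth[OF \<open>vs \<noteq> []\<close>] by (rule vs(4))
  note G' = simple_graphD[OF G]
  have finF: "finite F" using F(1) G'(4) finite_subset by blast
  then have F2: "2 \<le> card F" using card_cycle_edges_ge_2 vs(1,2) Fc by blast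
  have FE: "card F \<le> card E" using card_mono[OF G'(4) F(1)] .
  from connected_coverable[OF G True] show ?thesis
  proof
    assume E: "card E = card V - 1"
    \<comment> \<open>One member replaces the at least two edges of the cycle, so
      \<open>1 + (card V - 1 - card F)\<close> is at most \<open>card V - 2\<close>.\<close>
    have "ce_cover F [F]" unfolding ce_cover_iff using cycle_or_edge_cycle vs(1,2) Fc by auto
    then have "coverable F 1" unfolding coverable_def by force
    moreover have "coverable (E - F) (card (E - F))" using G'(3,4) by (intro coverable_single_edges) auto
    ultimately have "coverable (F \<union> (E - F)) (1 + card (E - F))" by (rule coverable_Un)
    moreover have "F \<union> (E - F) = E" using F(1) by blast
    moreover have "card (E - F) = card E - card F" using F(1) finF by (simp add: card_Diff_subset)
    ultimately show ?thesis using E F2 FE coverable_mono[of E "1 + card (E - F)" "card V - 2"] by auto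
  qed simp
next
  case False
  obtain V1 V2 E1 E2 where s: "V = V1 \<union> V2" "V1 \<inter> V2 = {}" "E = E1 \<union> E2"
    "simple_graph V1 E1" "simple_graph V2 E2" using disconnected_split[OF G False] .
  note c = split_card[OF s(1,2,4,5)]
  have "coverable E (card V1 - 1 + (card V2 - 1))"
    unfolding s(3) using coverable_pred_card s(4,5) by (intro coverable_Un) auto
  moreover have "card V1 - 1 + (card V2 - 1) = card V - 2" "2 \<le> card V" using c by auto
  ultimately show ?thesis by simp
qed

theorem theorem1p7:
  fixes V :: "'a set" and E :: "'a set set" and n :: nat
  assumes "simple_graph V E"
    and "card V = n"
    and "\<not> is_tree V E"
  shows "int (g_ce E) \<le> int n - 2 \<and>
    (\<exists>Es. ce_cover E Es \<and> int (length Es) \<le> int n - 2)"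
proof -
  obtain Es where Es: "ce_cover E Es" "length Es \<le> n - 2" "2 \<le> n"
    using coverable_if_not_tree[OF assms(1,3)] assms(2) unfolding coverable_def by blast
  have "g_ce E \<le> length Es" unfolding g_ce_def using Es(1) by (intro Least_le) blast
  with Es show ?thesis by (intro conjI exI[of _ Es]) auto
qed

end
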